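(* Let $m>1$ be an even integer and $r\in\mathbb{Z}$. For $\tau\in\mathbb{H}$, $q=e^{2\pi i\tau}$, let $\mathrm{ch}F_r(\tau)$ be defined by the Laurent expansion in $\zeta$, on the annulus $|q|^{1/2}<|\zeta|<|q|^{-1/2}$, $$\sum_{r\in\mathbb{Z}}\mathrm{ch}F_r(\tau)\zeta^r=\prod_{k\ge1}\frac{\left(1+\zeta q^{k-\frac12}\right)^m\left(1+\zeta^{-1}q^{k-\frac12}\right)^m}{\left(1-\zeta q^{k-\frac12}\right)^m\left(1-\zeta^{-1}q^{k-\frac12}\right)^m},$$ and set $\mathrm{tr}_{L_{m,m}(\Lambda_{(r)})}q^{L_0}:=\mathrm{ch}F_r(\tau)\prod_{k\ge1}(1-q^k)$. If $\tau=it$, then for any $N\in\mathbb{N}_0$, as $t\to0^+$, $$\mathrm{tr}_{L_{m,m}(\Lambda_{(r)})}q^{L_0}=e^{\frac{\pi t}{12}+\frac{\pi}{12t}(3m-1)}\frac{\sqrt t}{2^m}\left(\sum_{k=0}^N a_k(m,r)\frac{t^k}{k!}+O\left(t^{N+1}\right)\right),\qquad a_k(m,r):=(-2\pi i r)^k\mathcal{E}_{k,m}.$$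
   Context: The numbers $\mathcal{E}_{k,n}$ ($k\ge0$, $n\ge1$) are defined by $\mathcal{E}_{k,1}:=(-2i)^{-k}E_k$ and $\mathcal{E}_{k,2}:=\frac{2i^{-k}}{\pi}B_k\left(\frac12\right)$, where $E_k:=E_k(0)$ with Euler polynomials $\sum_{k\ge0}E_k(z)\frac{x^k}{k!}=\frac{2e^{xz}}{e^x+1}$ and Bernoulli polynomials $\sum_{k\ge0}B_k(z)\frac{x^k}{k!}=\frac{xe^{zx}}{e^x-1}$; and for $n\ge1$, $\mathcal{E}_{k,n+2}=\frac{n}{n+1}\mathcal{E}_{k,n}+\frac{k(k-1)}{\pi^2n(n+1)}\mathcal{E}_{k-2,n}$, with $\mathcal{E}_{k,n}:=0$ for $k<0$.
   Formalization: The recurrence for $\mathcal{E}_{k,n+2}$ is taken with a minus sign before $\frac{k(k-1)}{\pi^2 n(n+1)}\mathcal{E}_{k-2,n}$ instead of the printed plus; with plus the expansion fails, e.g. for $m=4$, $r=1$, $N=2$. *)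

theory Defs
  imports "HOL-Analysis.Analysis" "HOL-Library.Landau_Symbols"
    "HOL-Computational_Algebra.Formal_Power_Series"
begin

definition euler_polynomial :: "nat \<Rightarrow> complex \<Rightarrow> complex" where
  "euler_polynomial k z = fact k * fps_nth (2 * fps_exp z / (fps_exp 1 + 1)) k"

definition bernoulli_polynomial :: "nat \<Rightarrow> complex \<Rightarrow> complex" where
  "bernoulli_polynomial k z = fact k * fps_nth (fps_X * fps_exp z / (fps_exp 1 - 1)) k"

(* calE k n is the number E_{k,n}, n >= 1; the value at n = 0 is a dummy.

   The sign in the recurrence is minus.  It is printed as plus in the source, which is a
   misprint: for even n, E_{k,n} is the integral of z^k / cosh(pi z)^n over the real line, and
     (sech(pi z)^n)'' = pi^2 (n^2 sech(pi z)^n - n (n + 1) sech(pi z)^(n+2)),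
   so integrating z^k times this identity by parts twice gives the minus sign.  With plus, the
   asymptotic expansion built from E_{k,m} below is already false for m = 4, r = 1, N = 2.

   The value E_k = E_k(0) in the case n = 1 follows the source; it never enters E_{k,n} for
   even n. *)
fun calE :: "int \<Rightarrow> nat \<Rightarrow> complex" where
  "calE k 0 = 0"
| "calE k (Suc 0) =
     (if k < 0 then 0 else (- 2 * \<i>) powi (- k) * euler_polynomial (nat k) 0)"
| "calE k (Suc (Suc 0)) =
     (if k < 0 then 0
      else 2 * \<i> powi (- k) / of_real pi * bernoulli_polynomial (nat k) (1/2))"
| "calE k (Suc (Suc (Suc j))) =
     (let n = Suc j in
        of_nat n / of_nat (n + 1) * calE k n
        - of_int (k * (k - 1)) / (of_real pi ^ 2 * of_nat n * of_nat (n + 1)) * calE (k - 2) n)"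

(* q^x for q = exp(2 pi i tau), with the branch of q^(1/2) that is fixed by tau *)
definition qpow :: "complex \<Rightarrow> real \<Rightarrow> complex" where
  "qpow \<tau> x = exp (2 * of_real pi * \<i> * \<tau> * of_real x)"

definition laurent_annulus :: "complex \<Rightarrow> complex set" where
  "laurent_annulus \<tau> =
     {\<zeta>. cmod (qpow \<tau> 1) powr (1/2) < cmod \<zeta> \<and> cmod \<zeta> < cmod (qpow \<tau> 1) powr (-1/2)}"

(* The product over k >= 1 is indexed from 0, so q^(k - 1/2) becomes q^(k + 1/2). *)
definition chF_generating :: "nat \<Rightarrow> complex \<Rightarrow> complex \<Rightarrow> complex" where
  "chF_generating m \<tau> \<zeta> =
     (\<Prod>k. ((1 + \<zeta> * qpow \<tau> (real k + 1/2)) ^ m * (1 + inverse \<zeta> * qpow \<tau> (real k + 1/2)) ^ m) /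
          ((1 - \<zeta> * qpow \<tau> (real k + 1/2)) ^ m * (1 - inverse \<zeta> * qpow \<tau> (real k + 1/2)) ^ m))"

(* The r-th coefficient of the Laurent expansion on the annulus. *)
definition chF :: "nat \<Rightarrow> int \<Rightarrow> complex \<Rightarrow> complex" where
  "chF m r \<tau> =
     (THE c :: int \<Rightarrow> complex.
        \<forall>\<zeta>\<in>laurent_annulus \<tau>.
          ((\<lambda>s. c s * \<zeta> powi s) has_sum chF_generating m \<tau> \<zeta>) UNIV) r"

definition trL0 :: "nat \<Rightarrow> int \<Rightarrow> complex \<Rightarrow> complex" where
  "trL0 m r \<tau> = chF m r \<tau> * (\<Prod>k. 1 - qpow \<tau> 1 ^ Suc k)"

definition acoeff :: "nat \<Rightarrow> nat \<Rightarrow> int \<Rightarrow> complex" where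
  "acoeff k m r = (- 2 * of_real pi * \<i> * of_int r) ^ k * calE (int k) m"

end

theory Submission
  imports Defs "HOL-Complex_Analysis.Complex_Analysis" "HOL-Probability.Probability"
begin

text \<open>
  Put \<open>q = exp (- 2 \<pi> t)\<close> and \<open>p = exp (- 2 \<pi> / t)\<close>. In product form, the quotient of the theta
  functions for \<open>q\<close> and \<open>p\<close> that the modular inversion relates is entire and doubly periodic, hence
  constant by Liouville's theorem. Comparing the values at the three half periods, where Euler's
  identity makes the product of the theta values trivial, determines the constant and gives the
  transformation of \<open>\<Prod>(1 - q^k)\<close>. On the unit circle \<open>\<zeta> = exp (2 \<pi> \<i> x)\<close> the generating function
  thus becomes the \<open>m\<close>-th power of \<open>exp (\<pi> / 4t) / (2 cosh (\<pi> x / t))\<close>, up to a factor that is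
  exponentially close to 1. The coefficient \<open>ch F_r\<close> is the integral of this against
  \<open>exp (- 2 \<pi> \<i> r x)\<close> over \<open>\<bar>x\<bar> \<le> 1/2\<close>; substituting \<open>x = t u\<close> and expanding the exponential yields
  the expansion with the moments \<open>\<integral> u^k / cosh (\<pi> u)^m du\<close>. For even \<open>m\<close> these are the numbers
  \<open>calE k m\<close>: the recurrence is integration by parts, and for \<open>m = 2\<close> the exponential generating
  function of the moments is a Beta integral, \<open>B(1 + a, 1 - a) = \<pi> a / sin (\<pi> a)\<close>.
\<close>

section \<open>The \<open>q\<close>-Pochhammer symbol and theta functions\<close>

text \<open>The theta functions enter as bare products \<open>(u; q) (q / u; q)\<close>, without the
  factor \<open>(q; q)\<close> of the Jacobi triple product. The inversion then holds only up to a
  constant, which contains \<open>(q; q)^2 / (p; p)^2\<close>; finding that constant is the same as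
  proving the eta transformation. In the quotient that forms the generating function the constant
  cancels, so the eta transformation enters only through the extra product in the trace.

  The factor close to 1 is not uniformly so. At the ends of the range of \<open>x\<close> the dual
  variable \<open>y = exp (2 pi x / t)\<close> reaches \<open>1 / sqrt p\<close> or
  \<open>sqrt p\<close>, and the correction there is of order 1. Its deviation grows like
  \<open>sqrt p (y + 1 / y)\<close>, and it becomes harmless only after multiplication by the power
  of the hyperbolic secant, which decays at least like \<open>1 / (y + 1 / y)\<close> because
  \<open>m\<close> is at least 2.\<close>

definition qpoch :: "real \<Rightarrow> complex \<Rightarrow> complex" where
  "qpoch q w = (\<Prod>k. 1 - w * of_real q ^ k)"

lemma summable_geometric_mult:
  fixes q :: real
  assumes "0 < q" "q < 1"
  shows "summable (\<lambda>k. c * q ^ k)"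
  using assms by (intro summable_mult summable_geometric) auto

lemma qpoch_has_prod:
  assumes "0 < q" "q < 1"
  shows "(\<lambda>k. 1 - w * of_real q ^ k) has_prod qpoch q w"
proof -
  have "summable (\<lambda>k. norm ((1 - w * of_real q ^ k) - 1))"
    using summable_geometric_mult[OF assms, of "norm w"] assms
    by (simp add: norm_mult norm_power)
  then have "convergent_prod (\<lambda>k. 1 - w * of_real q ^ k)"
    by (intro abs_convergent_prod_imp_convergent_prod summable_imp_abs_convergent_prod)
  then show ?thesis
    unfolding qpoch_def by (rule convergent_prod_has_prod)
qed

lemma qpoch_eq_0_iff:
  assumes "0 < q" "q < 1"
  shows "qpoch q w = 0 \<longleftrightarrow> (\<exists>k. w * of_real q ^ k = 1)"
proof -
  have "qpoch q w = 0 \<longleftrightarrow> 0 \<in> range (\<lambda>k. 1 - w * of_real q ^ k)"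
    by (rule has_prod_eq_0_iff[OF qpoch_has_prod[OF assms]])
  also have "\<dots> \<longleftrightarrow> (\<exists>k. w * of_real q ^ k = 1)"
    by (auto simp: image_iff eq_commute[of 0])
  finally show ?thesis .
qed

lemma qpoch_nonzero:
  assumes "0 < q" "q < 1" "norm w < 1"
  shows "qpoch q w \<noteq> 0"
proof
  assume "qpoch q w = 0"
  then obtain k where "w * of_real q ^ k = 1"
    using qpoch_eq_0_iff[OF assms(1,2)] by blast
  then have "norm w * q ^ k = 1"
    using assms by (metis abs_of_pos norm_mult norm_of_real norm_one norm_power)
  moreover have "norm w * q ^ k \<le> norm w * 1"
    using assms by (intro mult_left_mono power_le_one) auto
  ultimately show False using assms by simp
qed

lemma qpoch_rec:
  assumes "0 < q" "q < 1"
  shows "qpoch q w = (1 - w) * qpoch q (w * of_real q)"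
\<comment> \<open>Peeling off the first factor of an infinite product requires it to be nonzero, so
  \<open>w = 1\<close> is treated apart; there both sides vanish.\<close>
proof (cases "w = 1")
  case True
  then have "qpoch q w = 0" by (subst qpoch_eq_0_iff[OF assms]) (auto intro: exI[of _ 0])
  with True show ?thesis by simp
next
  case False
  have "(\<lambda>k. 1 - w * of_real q ^ Suc k) has_prod qpoch q (w * of_real q)"
    using qpoch_has_prod[OF assms, of "w * of_real q"] by (simp add: mult_ac)
  then have "(\<lambda>k. 1 - w * of_real q ^ k) has_prod (qpoch q (w * of_real q) * (1 - w * of_real q ^ 0))"
    using False by (subst (asm) has_prod_Suc_iff) auto
  then show ?thesis using qpoch_has_prod[OF assms, of w] has_prod_unique2
    by (metis mult.commute mult.right_neutral power_0)
qed

text \<open>The M-test works locally: on the unit ball about \<open>x\<close> the factors differ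
  from 1 by at most \<open>(norm x + 1) * q ^ n\<close>.\<close>

lemma holomorphic_qpoch_UNIV:
  assumes "0 < q" "q < 1"
  shows "qpoch q holomorphic_on UNIV"
proof (rule holomorphic_uniform_sequence)
  let ?f = "\<lambda>n w. \<Prod>k<n. 1 - w * of_real q ^ k :: complex"
  show "\<exists>d>0. cball x d \<subseteq> UNIV \<and> uniform_limit (cball x d) ?f (qpoch q) sequentially" for x
  proof (intro exI[of _ 1] conjI)
    have "uniformly_convergent_on (cball x 1) ?f"
    proof (rule uniformly_convergent_on_prod')
      show "uniformly_convergent_on (cball x 1)
              (\<lambda>N w. \<Sum>n<N. norm (1 - w * complex_of_real q ^ n - 1))"
      proof (rule Weierstrass_m_test'_ev[where M = "\<lambda>n. (norm x + 1) * q ^ n"])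
        show "\<forall>\<^sub>F n in sequentially. \<forall>w\<in>cball x 1.
                norm (norm (1 - w * complex_of_real q ^ n - 1)) \<le> (norm x + 1) * q ^ n"
        proof (intro always_eventually allI ballI)
          fix n w assume "w \<in> cball x 1"
          then have "norm w \<le> norm x + 1"
            by (simp add: dist_norm) (smt (verit) norm_minus_commute norm_triangle_ineq2)
          then show "norm (norm (1 - w * complex_of_real q ^ n - 1)) \<le> (norm x + 1) * q ^ n"
            using assms by (auto simp: norm_mult norm_power intro!: mult_right_mono)
        qed
      qed (rule summable_geometric_mult[OF assms])
    qed (auto intro!: continuous_intros)
    then obtain l where l: "uniform_limit (cball x 1) ?f l sequentially"
      by (auto simp: uniformly_convergent_on_def)
    have "l w = qpoch q w" if "w \<in> cball x 1" for w
    proof (rule LIMSEQ_unique)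
      show "(\<lambda>n. ?f n w) \<longlonglongrightarrow> l w" by (rule tendsto_uniform_limitI[OF l that])
      show "(\<lambda>n. ?f n w) \<longlonglongrightarrow> qpoch q w"
        by (rule has_prod_imp_tendsto'[OF qpoch_has_prod[OF assms]])
    qed
    then show "uniform_limit (cball x 1) ?f (qpoch q) sequentially"
      using l uniform_limit_cong'[of "cball x 1" ?f ?f l "qpoch q"] by blast
  qed auto
qed (auto intro!: holomorphic_intros)

lemma holomorphic_on_qpoch [holomorphic_intros]:
  assumes "0 < q" "q < 1" "f holomorphic_on S"
  shows "(\<lambda>z. qpoch q (f z)) holomorphic_on S"
  using holomorphic_on_compose_gen[OF assms(3) holomorphic_qpoch_UNIV[OF assms(1,2)]]
  by (simp add: o_def)

lemma continuous_on_qpoch [continuous_intros]: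
  assumes "0 < q" "q < 1" "continuous_on S f"
  shows "continuous_on S (\<lambda>z. qpoch q (f z))"
  using continuous_on_compose2[OF holomorphic_on_imp_continuous_on[OF holomorphic_qpoch_UNIV] assms(3)] assms
  by auto

text \<open>Partial products of length \<open>2 * n\<close> split by the parity of the index. All
  limits are known to exist, so comparing along this subsequence suffices.\<close>

lemma qpoch_split_even_odd:
  assumes "0 < q" "q < 1"
  shows "qpoch q w = qpoch (q^2) w * qpoch (q^2) (w * of_real q)"
proof (rule LIMSEQ_unique)
  have q2: "0 < q^2" "q^2 < 1"
    using assms by (auto simp: power_less_one_iff)
  have "(\<lambda>n. \<Prod>k<n. 1 - w * of_real q ^ k) \<longlonglongrightarrow> qpoch q w"
    by (rule has_prod_imp_tendsto'[OF qpoch_has_prod[OF assms]])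
  then show "(\<lambda>n. \<Prod>k<2*n. 1 - w * of_real q ^ k) \<longlonglongrightarrow> qpoch q w"
    by (rule filterlim_compose) (intro mult_nat_left_at_top; simp)
  have "(\<Prod>k<2*n. 1 - w * of_real q ^ k) = (\<Prod>k<n. 1 - w * of_real (q^2) ^ k) *
          (\<Prod>k<n. 1 - w * of_real q * of_real (q^2) ^ k)" for n
    by (induction n) (simp_all add: power_mult[symmetric] mult_ac)
  moreover have "(\<lambda>n. (\<Prod>k<n. 1 - w * of_real (q^2) ^ k) *
          (\<Prod>k<n. 1 - w * of_real q * of_real (q^2) ^ k)) \<longlonglongrightarrow>
          qpoch (q^2) w * qpoch (q^2) (w * of_real q)"
    by (intro tendsto_mult has_prod_imp_tendsto'[OF qpoch_has_prod[OF q2]])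
  ultimately show "(\<lambda>n. \<Prod>k<2*n. 1 - w * of_real q ^ k) \<longlonglongrightarrow>
      qpoch (q^2) w * qpoch (q^2) (w * of_real q)"
    by simp
qed

lemma qpoch_mult_uminus:
  assumes "0 < q" "q < 1"
  shows "qpoch q w * qpoch q (-w) = qpoch (q^2) (w^2)"
proof (rule has_prod_unique2)
  have q2: "0 < q^2" "q^2 < 1"
    using assms by (auto simp: power_less_one_iff)
  show "(\<lambda>k. 1 - w^2 * of_real (q^2) ^ k) has_prod qpoch (q^2) (w^2)"
    by (rule qpoch_has_prod[OF q2])
  have "(\<lambda>k. (1 - w * of_real q ^ k) * (1 - (-w) * of_real q ^ k)) has_prod
          (qpoch q w * qpoch q (-w))"
    by (intro has_prod_mult qpoch_has_prod assms)
  then show "(\<lambda>k. 1 - w^2 * of_real (q^2) ^ k) has_prod (qpoch q w * qpoch q (-w))"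
    by (simp add: algebra_simps power2_eq_square power_mult_distrib)
qed

text \<open>With \<open>q = h^2\<close>, the parity split and the difference of squares give
  \<open>(q; q) = (q; q^2) (q; q) (-q; q)\<close>, and \<open>(q; q)\<close> cancels: Euler's
  theorem on odd and distinct parts. In terms of \<open>h\<close> the three factors are, up to
  elementary factors, square roots of the theta values at the half periods.\<close>

lemma qpoch_euler:
  assumes "0 < h" "h < 1"
  shows "qpoch (h^2) (of_real h) * qpoch (h^2) (- of_real h) * qpoch (h^2) (- (of_real h ^ 2)) = 1"
proof -
  define q where "q = h^2"
  have q: "0 < q" "q < 1" and q2: "0 < q^2" "q^2 < 1"
    using assms by (auto simp: power_less_one_iff q_def)
  let ?q = "complex_of_real q"
  have "qpoch q ?q = qpoch (q^2) ?q * qpoch (q^2) (?q^2)"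
    using qpoch_split_even_odd[OF q, of ?q] by (simp add: power2_eq_square)
  also have "qpoch (q^2) (?q^2) = qpoch q ?q * qpoch q (-?q)"
    using qpoch_mult_uminus[OF q, of ?q] by simp
  finally have "qpoch q ?q * (qpoch (q^2) ?q * qpoch q (-?q)) = qpoch q ?q * 1"
    by (simp add: mult_ac)
  moreover have "qpoch q ?q \<noteq> 0"
    using q by (intro qpoch_nonzero) auto
  ultimately have "qpoch (q^2) ?q * qpoch q (-?q) = 1"
    by (metis mult_left_cancel)
  moreover have "qpoch q (of_real h) * qpoch q (- of_real h) = qpoch (q^2) ?q"
    using qpoch_mult_uminus[OF q, of "of_real h"] by (simp add: q_def)
  ultimately show ?thesis by (simp add: q_def)
qed

lemma qpoch_of_real:
  assumes "0 < q" "q < 1" 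
  shows "\<exists>y. qpoch q (of_real x) = of_real y \<and> (\<lambda>k. 1 - x * q ^ k) has_prod y"
proof -
  have "convergent_prod (\<lambda>k. 1 - x * q ^ k)"
    using summable_geometric_mult[OF assms, of "\<bar>x\<bar>"] assms
    by (intro abs_convergent_prod_imp_convergent_prod summable_imp_abs_convergent_prod)
       (simp add: abs_mult power_abs)
  then obtain y where y: "(\<lambda>k. 1 - x * q ^ k) has_prod y" by blast
  then have "(\<lambda>k. 1 - of_real x * complex_of_real q ^ k) has_prod of_real y"
    by (subst (asm) has_prod_of_real_iff[where 'a=complex, symmetric]) simp
  with qpoch_has_prod[OF assms] y show ?thesis
    using has_prod_unique2 by blast
qed

section \<open>Modular inversion of the theta function in product form\<close>

definition jtheta :: "real \<Rightarrow> complex \<Rightarrow> complex" where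
  "jtheta q u = qpoch q u * qpoch q (of_real q / u)"

text \<open>Replacing \<open>u\<close> by \<open>u * q\<close> removes the factor
  \<open>1 - u\<close> and brings in \<open>1 - 1 / u\<close>; their quotient is
  \<open>- 1 / u\<close>.\<close>

lemma jtheta_shift:
  assumes "0 < q" "q < 1" "u \<noteq> 0"
  shows "jtheta q (u * of_real q) = - jtheta q u / u"
proof -
  have "of_real q / (u * of_real q) = 1 / u" using assms by simp
  then have "jtheta q (u * of_real q) * (- u) =
      (- u * (1 - 1 / u)) * qpoch q (u * of_real q) * qpoch q (of_real q / u)"
    unfolding jtheta_def using qpoch_rec[OF assms(1,2), of "1 / u"] by simp
  also have "- u * (1 - 1 / u) = 1 - u" using assms by (simp add: field_simps)
  also have "(1 - u) * qpoch q (u * of_real q) * qpoch q (of_real q / u) = jtheta q u"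
    unfolding jtheta_def by (simp add: qpoch_rec[OF assms(1,2), of u])
  finally have "u * jtheta q (u * of_real q) = - jtheta q u" by (simp add: mult.commute minus_equation_iff)
  then show ?thesis using assms by (simp add: field_simps)
qed

lemma jtheta_shift':
  assumes "0 < q" "q < 1" "u \<noteq> 0"
  shows "jtheta q (u / of_real q) = - u / of_real q * jtheta q u"
  using jtheta_shift[of q "u / of_real q"] assms by (simp add: field_simps)

text \<open>Isolates the factor that carries the zero at \<open>u = 1\<close>; for
  \<open>q < norm u < 1 / q\<close> the other two do not vanish.\<close>

lemma jtheta_eq: 
  assumes "0 < q" "q < 1" 
  shows "jtheta q u = (1 - u) * qpoch q (of_real q * u) * qpoch q (of_real q / u)"
  unfolding jtheta_def by (subst qpoch_rec[OF assms]) (simp add: mult_ac)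

lemma tendsto_exp_quotient:
  fixes a b :: complex
  assumes "b \<noteq> 0"
  shows "((\<lambda>w. (1 - exp (a * w)) / (1 - exp (b * w))) \<longlongrightarrow> a / b) (at 0)"
proof -
  have *: "((\<lambda>w. (exp (c * w) - 1) / w) \<longlongrightarrow> c) (at 0)" for c :: complex
  proof -
    have "((\<lambda>w. exp (c * w)) has_field_derivative c) (at 0)"
      by (auto intro!: derivative_eq_intros)
    then show ?thesis by (simp add: has_field_derivative_iff)
  qed
  have "((\<lambda>w. ((exp (a * w) - 1) / w) / ((exp (b * w) - 1) / w)) \<longlongrightarrow> a / b) (at 0)"
    by (intro tendsto_divide * assms)
  then show ?thesis
  proof (rule Lim_transform_eventually)
    show "\<forall>\<^sub>F w in at 0. (exp (a * w) - 1) / w / ((exp (b * w) - 1) / w) =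
        (1 - exp (a * w)) / (1 - exp (b * w))"
      unfolding eventually_at_filter
      by (intro always_eventually) (auto simp: divide_simps algebra_simps)
  qed
qed

text \<open>\<open>K\<close> is forced by the behaviour at \<open>w = 0\<close>: both theta
  functions vanish simply there, with derivatives in the ratio \<open>\<i> * t\<close> times the
  square of the quotient of the remaining products. The hypothesis \<open>nz\<close> selects the
  points where \<open>h\<close> is a true quotient.\<close>

theorem jtheta_modular:
  fixes t q p :: real and w :: complex
  assumes t: "t > 0"
  defines "q \<equiv> exp (-2 * pi * t)" and "p \<equiv> exp (-2 * pi / t)"
  defines "K \<equiv> t * (qpoch q q / qpoch p p) ^ 2"
  assumes nz: "jtheta p (exp (2 * pi * w / t)) \<noteq> 0"
  shows "jtheta q (exp (2 * pi * \<i> * w)) =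
           \<i> * K * exp (pi * \<i> * w - pi * w^2 / t - pi * w / t) * jtheta p (exp (2 * pi * w / t))"
proof -
  have q: "0 < q" "q < 1" and p: "0 < p" "p < 1"
    using t by (auto simp: q_def p_def)
  have cq: "complex_of_real q = exp (of_real (-2 * pi * t))" and cp: "complex_of_real p = exp (of_real (-2 * pi / t))"
    by (simp_all only: q_def p_def exp_of_real)
  \<comment> \<open>The exponentials equalise the multipliers: \<open>exp (- pi * \<i> * w)\<close>
    turns the period 1 of the first theta function into a sign change, and the Gaussian gives
    \<open>g\<close> the same sign under 1 and the same factor \<open>- E w\<close> under
    \<open>\<i> * t\<close>.\<close>
  define f where "f = (\<lambda>w::complex. exp (- pi * \<i> * w) * jtheta q (exp (2 * pi * \<i> * w)))"
  define g where "g = (\<lambda>w::complex. exp (- pi * w^2 / t - pi * w / t) * jtheta p (exp (2 * pi * w / t)))"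
  \<comment> \<open>The default value \<open>\<i> * K\<close> is the limit of \<open>f / g\<close>
    at 0, so it fills in the removable singularities at 0 and its translates.\<close>
  define h where "h = (\<lambda>w. if g w = 0 then \<i> * K else f w / g w)"
  have f1: "f (w + 1) = - f w" for w
    by (simp add: f_def algebra_simps exp_add exp_diff exp_minus)
  have g1: "g (w + 1) = - g w" for w
  proof -
    have "exp (2 * pi * (w + 1) / t) = exp (2 * pi * w / t) / p"
      unfolding cp by (simp add: exp_diff[symmetric] add_divide_distrib ring_distribs)
    then have "jtheta p (exp (2 * pi * (w + 1) / t)) = - exp (2 * pi * w / t) / p * jtheta p (exp (2 * pi * w / t))"
      using jtheta_shift'[OF p, of "exp (2 * pi * w / t)"] by simp
    also have "- exp (2 * pi * w / t) / complex_of_real p = - exp (2 * pi * w / t + 2 * pi / t)"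
      unfolding cp by (simp add: exp_diff[symmetric] )
    finally have "g (w + 1) = - (exp (- pi * (w+1)^2 / t - pi * (w+1) / t) * exp (2 * pi * w / t + 2 * pi / t)) * jtheta p (exp (2 * pi * w / t))"
      unfolding g_def by simp
    also have "exp (- pi * (w+1)^2 / t - pi * (w+1) / t) * exp (2 * pi * w / t + 2 * pi / t) = exp (- pi * w^2 / t - pi * w / t)"
      unfolding exp_add[symmetric] using t 
      by (intro arg_cong[where f = exp]) (simp add: field_simps power2_eq_square)
    finally show ?thesis by (simp add: g_def)
  qed
  define E where "E = (\<lambda>w::complex. exp (pi * t - 2 * pi * \<i> * w))"
  have f2: "f (w + \<i> * t) = - E w * f w" for w
  proof -
    have "exp (2 * pi * \<i> * (w + \<i> * t)) = exp (2 * pi * \<i> * w) * q"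
      unfolding cq by (simp add: exp_add[symmetric] algebra_simps)
    then have "jtheta q (exp (2 * pi * \<i> * (w + \<i> * t))) = - exp (- (2 * pi * \<i> * w)) * jtheta q (exp (2 * pi * \<i> * w))"
      using jtheta_shift[OF q, of "exp (2 * pi * \<i> * w)"] by (simp add: exp_minus field_simps)
    then have "f (w + \<i> * t) = - (exp (- pi * \<i> * (w + \<i> * t)) * exp (- (2 * pi * \<i> * w))) * jtheta q (exp (2 * pi * \<i> * w))"
      unfolding f_def by simp
    also have "exp (- pi * \<i> * (w + \<i> * t)) * exp (- (2 * pi * \<i> * w)) = E w * exp (- pi * \<i> * w)"
      unfolding E_def exp_add[symmetric] by (intro arg_cong[where f = exp]) (simp add: algebra_simps)
    finally show ?thesis by (simp add: f_def)
  qed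
  have g2: "g (w + \<i> * t) = - E w * g w" for w
  proof -
    have "exp (2 * pi * (w + \<i> * t) / t) = exp (2 * pi * w / t)"
      using t by (simp add: add_divide_distrib ring_distribs exp_add mult_ac)
    then have "g (w + \<i> * t) = exp (- pi * (w + \<i> * t)^2 / t - pi * (w + \<i> * t) / t) * jtheta p (exp (2 * pi * w / t))"
      unfolding g_def by simp
    also have "- pi * (w + \<i> * t)^2 / t - pi * (w + \<i> * t) / t = (pi * t - 2 * pi * \<i> * w) + (- pi * w^2 / t - pi * w / t) - pi * \<i>"
      using t by (simp add: field_simps power2_eq_square)
    also have "exp \<dots> = - E w * exp (- pi * w^2 / t - pi * w / t)"
      by (simp add: E_def exp_add exp_diff mult_ac)
    finally show ?thesis by (simp add: g_def)
  qed
  have E: "E w \<noteq> 0" for w by (simp add: E_def)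
  interpret h1: periodic_fun_simple h 1
    by standard (auto simp: h_def f1 g1)
  interpret h2: periodic_fun_simple h "\<i> * t"
    by standard (use E in \<open>auto simp: h_def f2 g2\<close>)
  have h_per: "h (z + of_int m + of_int n * (\<i> * t)) = h z" for z m n
    using h1.plus_of_int[of z m] h2.plus_of_int[of "z + of_int m" n] by simp
  \<comment> \<open>Rounding centres the period cell at 0, which is then an interior point and the
    only zero of \<open>g\<close> in the closed cell.\<close>
  have red: "\<exists>z1 m n. z = z1 + of_int m + of_int n * (\<i> * t) \<and> \<bar>Re z1\<bar> \<le> 1/2 \<and> \<bar>Im z1\<bar> \<le> t/2" for z
  proof -
    define m where "m = round (Re z)"
    define n where "n = round (Im z / t)"
    have 1: "\<bar>Re z - m\<bar> \<le> 1/2" using of_int_round_abs_le[of "Re z"] by (simp add: m_def abs_minus_commute)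
    have "\<bar>Im z / t - n\<bar> \<le> 1/2" using of_int_round_abs_le[of "Im z / t"] by (simp add: n_def abs_minus_commute)
    then have "\<bar>Im z / t - n\<bar> * t \<le> 1/2 * t" using t by (intro mult_right_mono) auto
    moreover have "Im z - n * t = (Im z / t - n) * t" using t by (simp add: field_simps)
    ultimately have "\<bar>Im z - n * t\<bar> \<le> t/2" using t by (simp add: abs_mult)
    with 1 show ?thesis
      by (intro exI[of _ "z - of_int m - of_int n * (\<i> * t)"] exI[of _ m] exI[of _ n]) auto
  qed
  have g0: "g z = 0 \<longleftrightarrow> z = 0" if "\<bar>Re z\<bar> \<le> 1/2" "\<bar>Im z\<bar> \<le> t/2" for z
  proof -
    have "\<bar>pi * Re z\<bar> < pi" using that by (simp add: abs_mult)
    then have re: "pi * Re z < pi" "- (pi * Re z) < pi"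
      by linarith+
    have "norm (p * exp (2 * pi * z / t)) = exp (2 * pi * Re z / t - 2 * pi / t)"
      by (simp add: norm_mult p_def exp_add[symmetric] exp_diff[symmetric])
    also have "\<dots> < 1"
      using re t by (auto simp: field_simps)
    finally have 1: "norm (p * exp (2 * pi * z / t)) < 1" .
    have "norm (p / exp (2 * pi * z / t)) = exp (- 2 * pi * Re z / t - 2 * pi / t)"
      by (simp add: norm_divide p_def exp_diff[symmetric])
    also have "\<dots> < 1"
      using re t by (auto simp: field_simps)
    finally have 2: "norm (p / exp (2 * pi * z / t)) < 1" .
    have "g z = 0 \<longleftrightarrow> exp (2 * pi * z / t) = 1"
      unfolding g_def jtheta_eq[OF p] using qpoch_nonzero[OF p 1] qpoch_nonzero[OF p 2] by auto
    also have "\<dots> \<longleftrightarrow> z = 0"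
    proof
      assume "exp (2 * pi * z / t) = 1"
      then obtain n :: int where n: "Re z = 0" "2 * pi * Im z / t = of_int (2 * n) * pi"
        using t by (auto simp: exp_eq_1 )
      then have im: "Im z = n * t" using t by (simp add: field_simps)
      then have "\<bar>real_of_int n\<bar> * t \<le> 1/2 * t" using that t by (simp add: abs_mult)
      then have "\<bar>real_of_int n\<bar> \<le> 1/2" using t by (simp only: mult_le_cancel_right_pos)
      then have "n = 0" by linarith
      with n(1) im show "z = 0" by (simp add: complex_eq_iff)
    qed auto
    finally show ?thesis .
  qed
  have fholo: "f holomorphic_on A" and gholo: "g holomorphic_on A" for A
    unfolding f_def g_def jtheta_def using q p t by (auto intro!: holomorphic_intros)
  define r where "r = min (1/2) (t/2)"
  have r: "r > 0" using t by (simp add: r_def)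
  have in_ball: "\<bar>Re z\<bar> \<le> 1/2" "\<bar>Im z\<bar> \<le> t/2" if "z \<in> ball 0 r" for z
    using that abs_Re_le_cmod[of z] abs_Im_le_cmod[of z] by (auto simp: r_def)
  have hball: "h holomorphic_on ball 0 r"
  proof -
    have "(\<lambda>z. f z / g z) holomorphic_on ball 0 r - {0}"
      using g0 in_ball by (intro holomorphic_intros fholo gholo) auto
    moreover have "(\<lambda>z. f z / g z) \<midarrow>0\<rightarrow> \<i> * K"
    proof -
      define F where "F = (\<lambda>w::complex. exp (- pi * \<i> * w) * (qpoch q (q * exp (2 * pi * \<i> * w)) * qpoch q (q / exp (2 * pi * \<i> * w))))"
      define G where "G = (\<lambda>w::complex. exp (- pi * w^2 / t - pi * w / t) * (qpoch p (p * exp (2 * pi * w / t)) * qpoch p (p / exp (2 * pi * w / t))))"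
      have "continuous_on UNIV F" "continuous_on UNIV G"
        unfolding F_def G_def using q p t by (auto intro!: continuous_intros)
      then have "(F \<longlongrightarrow> F 0) (at 0)" "(G \<longlongrightarrow> G 0) (at 0)"
        by (auto simp: continuous_on_def)
      moreover have "G 0 \<noteq> 0"
        unfolding G_def using qpoch_nonzero[OF p] p by simp
      ultimately have "((\<lambda>w::complex. F w / G w * ((1 - exp (2 * pi * \<i> * w)) / (1 - exp (of_real (2 * pi / t) * w)))) \<longlongrightarrow>
          F 0 / G 0 * (2 * pi * \<i> / (2 * pi / t))) (at 0)"
        using t by (intro tendsto_mult[OF tendsto_divide tendsto_exp_quotient]) auto
      moreover have "F (w::complex) / G w * ((1 - exp (2 * pi * \<i> * w)) / (1 - exp (of_real (2 * pi / t) * w))) = f w / g w" for w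
        unfolding f_def g_def F_def G_def jtheta_eq[OF p] jtheta_eq[OF q] by (simp add: mult_ac)
      moreover have "F 0 / G 0 * (2 * pi * \<i> / (2 * pi / t)) = \<i> * K"
        unfolding F_def G_def K_def using t by (simp add: field_simps power2_eq_square)
      ultimately show ?thesis by simp
    qed
    ultimately have "(\<lambda>y. if y = 0 then \<i> * K else f y / g y) holomorphic_on ball 0 r"
      by (intro removable_singularity) auto
    then show ?thesis
      by (rule holomorphic_transform) (use g0 in_ball in \<open>auto simp: h_def\<close>)
  qed
  \<comment> \<open>A point congruent to 0 inherits differentiability from the ball around 0,
    translated by the period \<open>c\<close>. At any other point \<open>g\<close> is nonzero,
    because its zero set is periodic as well.\<close>
  have "h field_differentiable at z" for z
  proof -
    obtain z1 m n where z: "z = z1 + of_int m + of_int n * (\<i> * t)" "\<bar>Re z1\<bar> \<le> 1/2" "\<bar>Im z1\<bar> \<le> t/2"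
      using red by blast
    define c where "c = of_int m + of_int n * (\<i> * t)"
    have hc: "h (w + c) = h w" for w using h_per[of w m n] by (simp add: c_def add_ac)
    show ?thesis
    proof (cases "z1 = 0")
      case True
      then have "z = c" using z by (simp add: c_def)
      have "(\<lambda>w. h (w - c)) holomorphic_on ball c r"
        by (rule holomorphic_on_compose_gen[OF _ hball, unfolded o_def])
           (auto intro!: holomorphic_intros simp: dist_norm norm_minus_commute)
      moreover have "h (w - c) = h w" for w using hc[of "w - c"] by simp
      ultimately have "h holomorphic_on ball c r" by simp
      then show ?thesis
        using r \<open>z = c\<close> by (intro holomorphic_on_imp_differentiable_at[of h "ball c r"]) auto
    next
      case False
      have per: "(g (w + c) = 0) = (g w = 0)" for w
      proof -
        interpret g1: periodic_fun_simple "\<lambda>w. g w = 0" 1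
          by standard (auto simp: g1)
        interpret g2: periodic_fun_simple "\<lambda>w. g w = 0" "\<i> * t"
          by standard (use E in \<open>auto simp: g2\<close>)
        show ?thesis
          using g1.plus_of_int[of w m] g2.plus_of_int[of "w + of_int m" n] by (simp add: c_def add_ac)
      qed
      have "g z \<noteq> 0" using False g0[of z1] z per[of z1] by (simp add: c_def add_ac)
      have op: "open {w. g w \<noteq> 0}"
        by (rule open_Collect_neq) (auto intro: holomorphic_on_imp_continuous_on[OF gholo])
      have "(\<lambda>w. f w / g w) holomorphic_on {w. g w \<noteq> 0}"
        by (intro holomorphic_intros fholo gholo) auto
      then have "h holomorphic_on {w. g w \<noteq> 0}"
        by (rule holomorphic_transform) (auto simp: h_def)
      then show ?thesis
        using op \<open>g z \<noteq> 0\<close> by (intro holomorphic_on_imp_differentiable_at[of h "{w. g w \<noteq> 0}"]) auto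
    qed
  qed
  then have hholo: "h holomorphic_on UNIV"
    by (auto simp: holomorphic_on_def intro: field_differentiable_at_within)
  \<comment> \<open>By periodicity \<open>h\<close> takes all its values on the period cell, which
    lies in a compact disc.\<close>
  have "bounded (range h)"
  proof (rule bounded_subset)
    show "bounded (h ` cball 0 (1/2 + t/2))"
      by (intro compact_imp_bounded compact_continuous_image
            holomorphic_on_imp_continuous_on[OF holomorphic_on_subset[OF hholo]]) auto
    show "range h \<subseteq> h ` cball 0 (1/2 + t/2)"
    proof
      fix y assume "y \<in> range h"
      then obtain z where y: "y = h z" by blast
      obtain z1 m n where z: "z = z1 + of_int m + of_int n * (\<i> * t)" "\<bar>Re z1\<bar> \<le> 1/2" "\<bar>Im z1\<bar> \<le> t/2"
        using red by blast
      have "norm z1 \<le> 1/2 + t/2" using cmod_le[of z1] z by linarith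
      then show "y \<in> h ` cball 0 (1/2 + t/2)"
        using h_per[of z1 m n] by (auto simp: y z(1))
    qed
  qed
  then obtain c where c: "h z = c" for z
    using Liouville_theorem[OF hholo] by (auto simp: constant_on_def)
  have "g 0 = 0" using g0[of 0] t by simp
  then have "c = \<i> * K" using c[of 0] by (simp add: h_def)
  moreover have "g w \<noteq> 0" using nz by (simp add: g_def)
  ultimately have "f w = \<i> * K * g w" using c[of w] by (simp add: h_def field_simps)
  then have "exp (pi * \<i> * w) * f w = exp (pi * \<i> * w) * (\<i> * K * g w)" by simp
  also have "exp (pi * \<i> * w) * f w = jtheta q (exp (2 * pi * \<i> * w))"
    by (simp add: f_def exp_add[symmetric] mult.assoc[symmetric])
  also have "exp (pi * \<i> * w) * (\<i> * K * g w) = \<i> * K * exp (pi * \<i> * w + (- pi * w^2 / t - pi * w / t)) * jtheta p (exp (2 * pi * w / t))"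
    unfolding g_def exp_add by (simp only: mult_ac)
  finally show ?thesis by (simp add: algebra_simps)
qed

section \<open>Real values, half periods and the eta transformation\<close>

definition qpoch_real :: "real \<Rightarrow> real \<Rightarrow> real" where
  "qpoch_real q x = Re (qpoch q (of_real x))"

lemma exp_pi_half:
  "exp (of_real (pi / 2) * \<i>) = \<i>" "exp (of_real (- pi / 2) * \<i>) = - \<i>"
  using cis_conv_exp[of "pi / 2"] cis_conv_exp[of "- pi / 2"] by (simp_all add: mult.commute)

lemma qpoch_real_has_prod:
  assumes "0 < q" "q < 1"
  shows "(\<lambda>k. 1 - x * q ^ k) has_prod qpoch_real q x"
  using qpoch_of_real[OF assms, of x] by (auto simp: qpoch_real_def)

lemma qpoch_of_real_eq:
  assumes "0 < q" "q < 1"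
  shows "qpoch q (of_real x) = of_real (qpoch_real q x)"
  using qpoch_of_real[OF assms, of x] by (auto simp: qpoch_real_def)

lemma qpoch_real_pos:
  assumes "0 < q" "q < 1" "x < 1"
  shows "qpoch_real q x > 0"
proof (rule has_prod_pos[OF qpoch_real_has_prod[OF assms(1,2)]])
  fix k
  have "x * q ^ k < 1"
  proof (cases "x > 0")
    case True
    then have "x * q ^ k \<le> x * 1" using assms by (intro mult_left_mono power_le_one) auto
    then show ?thesis using assms by simp
  next
    case False
    then have "x * q ^ k \<le> 0" using assms by (intro mult_nonpos_nonneg) auto
    then show ?thesis by simp
  qed
  then show "1 - x * q ^ k > 0" by simp
qed

text \<open>Factorwise \<open>1 \<le> 1 + z \<le> exp z\<close> with \<open>z = x * q ^ k\<close>;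
  the exponents add up to a geometric series.\<close>

lemma qpoch_real_neg_bounds:
  assumes "0 < q" "q < 1" "x \<ge> 0"
  shows "1 \<le> qpoch_real q (- x)" "qpoch_real q (- x) \<le> exp (x / (1 - q))"
proof -
  have *: "(\<lambda>k. 1 - (-x) * q ^ k) has_prod qpoch_real q (- x)"
    by (rule qpoch_real_has_prod[OF assms(1,2)])
  show "1 \<le> qpoch_real q (- x)"
    by (rule has_prod_le[OF has_prod_one *]) (use assms in auto)
  have "(\<lambda>k. x * q ^ k) sums (x * (1 / (1 - q)))"
    using assms by (intro sums_mult geometric_sums) auto
  then have "(\<lambda>k. exp (x * q ^ k)) has_prod exp (x / (1 - q))"
    using sums_imp_has_prod_exp by (auto simp: has_prod_def)
  then show "qpoch_real q (- x) \<le> exp (x / (1 - q))"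
    using assms by (rule_tac has_prod_le[OF *]) auto
qed

text \<open>\<open>-1\<close>, \<open>h\<close> and \<open>- h\<close> are the half-period values of
  \<open>u\<close>. The points \<open>1 / h\<close> and \<open>- 1 / h\<close> occur on the dual
  side, where \<open>w = 1/2\<close> gives \<open>exp (pi / t)\<close>, the inverse of the dual
  nome; one shift brings them back.\<close>

lemma jtheta_special_values:
  fixes h :: real
  assumes h: "0 < h" "h < 1"
  shows "jtheta (h^2) (-1) = of_real (2 * qpoch_real (h^2) (- (h^2)) ^ 2)"
    and "jtheta (h^2) (of_real h) = of_real (qpoch_real (h^2) h ^ 2)"
    and "jtheta (h^2) (- of_real h) = of_real (qpoch_real (h^2) (- h) ^ 2)"
    and "jtheta (h^2) (1 / of_real h) = - of_real (qpoch_real (h^2) h ^ 2 / h)"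
    and "jtheta (h^2) (- (1 / of_real h)) = of_real (qpoch_real (h^2) (- h) ^ 2 / h)"
proof -
  define q where "q = h^2"
  have q: "0 < q" "q < 1" using h by (auto simp: q_def power_less_one_iff)
  have qdivh: "complex_of_real q / of_real h = of_real h"
    using h by (simp add: q_def power2_eq_square)
  have hdivq: "complex_of_real h / of_real q = 1 / of_real h"
    using h by (simp add: q_def power2_eq_square)
  have "qpoch q (-1) = 2 * qpoch q (- of_real q)"
    using qpoch_rec[OF q, of "-1"] by simp
  then show "jtheta q (-1) = of_real (2 * qpoch_real q (- q) ^ 2)"
    unfolding jtheta_def using qpoch_of_real_eq[OF q, of "-q"]
    by (simp add: power2_eq_square)
  show 1: "jtheta q (of_real h) = of_real (qpoch_real q h ^ 2)"
    unfolding jtheta_def qdivh using qpoch_of_real_eq[OF q, of h]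
    by (simp add: power2_eq_square)
  show 2: "jtheta q (- of_real h) = of_real (qpoch_real q (- h) ^ 2)"
    unfolding jtheta_def using qpoch_of_real_eq[OF q, of "-h"] qdivh
    by (simp add: power2_eq_square)
  show "jtheta q (1 / of_real h) = - of_real (qpoch_real q h ^ 2 / h)"
    using jtheta_shift'[OF q, of "of_real h"] h by (simp add: hdivq 1 mult_ac)
  show "jtheta q (- (1 / of_real h)) = of_real (qpoch_real q (- h) ^ 2 / h)"
    using jtheta_shift'[OF q, of "- of_real h"] h by (simp add: hdivq 2 mult_ac)
qed

text \<open>This is \<open>\<eta>(i t) = \<eta>(i / t) / sqrt t\<close>. The inversion permutes the
  half periods \<open>1/2\<close>, \<open>\<i> t / 2\<close> and \<open>1/2 + \<i> t / 2\<close>, so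
  multiplying its three instances produces Euler's product, squared, on both sides and leaves
  \<open>K ^ 3\<close> times an explicit exponential equal to 1.\<close>

lemma eta_modular:
  fixes t :: real
  assumes t: "t > 0"
  defines "q \<equiv> exp (-2 * pi * t)" and "p \<equiv> exp (-2 * pi / t)"
  shows "qpoch_real q q = exp (pi * t / 12 - pi / (12 * t)) / sqrt t * qpoch_real p p"
proof -
  define h where "h = exp (- pi * t)"
  define k where "k = exp (- pi / t)"
  have q: "0 < q" "q < 1" and p: "0 < p" "p < 1" and h: "0 < h" "h < 1" and k: "0 < k" "k < 1"
    using t by (auto simp: q_def p_def h_def k_def)
  have qh: "q = h^2" and pk: "p = k^2"
    by (simp_all add: q_def p_def h_def k_def exp_double[symmetric])
  define K where "K = t * (qpoch_real q q / qpoch_real p p) ^ 2"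
  have Kc: "of_real t * (qpoch q (of_real q) / qpoch p (of_real p)) ^ 2 = complex_of_real K"
    by (simp add: K_def qpoch_of_real_eq q p)
  have modular: "jtheta p (exp (2 * of_real pi * w / of_real t)) \<noteq> 0 \<Longrightarrow> jtheta q (exp (2 * of_real pi * \<i> * w)) =
     \<i> * of_real K * exp (of_real pi * \<i> * w - of_real pi * w^2 / of_real t - of_real pi * w / of_real t) * jtheta p (exp (2 * of_real pi * w / of_real t))" for w
    using jtheta_modular[OF t, of w] unfolding q_def[symmetric] p_def[symmetric]  by (simp add: Kc)
  let ?A = "qpoch_real q" and ?B = "qpoch_real p"
  have Bpos: "?B x > 0" if "x < 1" for x using qpoch_real_pos[OF p that] .
  note jA = jtheta_special_values[OF h, folded qh] and jB = jtheta_special_values[OF k, folded pk]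
  have kexp: "1 / k = exp (pi / t)"
    by (simp add: k_def exp_minus field_simps)
  have 1: "2 * ?A (- q) ^ 2 = K * exp (pi / (4 * t)) * ?B k ^ 2"
  proof -
    have e: "exp (2 * of_real pi * (1/2) / of_real t) = 1 / complex_of_real k"
    proof -
      have "2 * of_real pi * (1/2) / of_real t = complex_of_real (pi / t)" by simp
      then show ?thesis by (simp only: exp_of_real kexp[symmetric]) simp
    qed
    have "jtheta q (exp (2 * of_real pi * \<i> * (1/2))) = \<i> * of_real K * exp (of_real pi * \<i> * (1/2) - of_real pi * (1/2)^2 / of_real t - of_real pi * (1/2) / of_real t) * jtheta p (1 / of_real k)"
      by (rule modular[of "1/2", unfolded e]) (use Bpos[of k] k in \<open>simp add: jB\<close>)
    also have "exp (2 * of_real pi * \<i> * (1/2)) = -1" by simp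
    also have "of_real pi * \<i> * (1/2) - of_real pi * (1/2)^2 / of_real t - of_real pi * (1/2) / of_real t = of_real (pi / 2) * \<i> + of_real (- 3 * pi / (4 * t))"
      using t by (simp add: field_simps power2_eq_square)
    also have "exp \<dots> = \<i> * of_real (exp (- 3 * pi / (4 * t)))"
      unfolding exp_add exp_of_real exp_pi_half by simp
    finally have "complex_of_real (2 * ?A (- q) ^ 2) = of_real (K * exp (- 3 * pi / (4 * t)) * (1 / k) * ?B k ^ 2)"
      unfolding jA jB by (simp add: mult_ac)
    then have "2 * ?A (- q) ^ 2 = K * (exp (- 3 * pi / (4 * t)) * (1 / k)) * ?B k ^ 2"
      by (simp only: of_real_eq_iff mult_ac)
    also have "exp (- 3 * pi / (4 * t)) * (1 / k) = exp (pi / (4 * t))"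
      unfolding kexp exp_add[symmetric] using t by (simp add: field_simps)
    finally show ?thesis .
  qed
  have 2: "?A h ^ 2 = K * exp (- pi * t / 4) * (2 * ?B (- p) ^ 2)"
  proof -
    have e: "exp (2 * of_real pi * (\<i> * of_real t / 2) / of_real t) = - 1"
      using t by (simp add: mult_ac)
    have "exp (2 * of_real pi * \<i> * (\<i> * of_real t / 2)) = of_real h"
      unfolding h_def exp_of_real[symmetric] by (simp add: algebra_simps)
    then have "jtheta q (of_real h) = \<i> * of_real K * exp (of_real pi * \<i> * (\<i> * of_real t / 2) - of_real pi * (\<i> * of_real t / 2)^2 / of_real t - of_real pi * (\<i> * of_real t / 2) / of_real t) * jtheta p (- 1)"
      using modular[of "\<i> * of_real t / 2", unfolded e] Bpos[of "-p"] p by (simp add: jB)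
    also have "of_real pi * \<i> * (\<i> * of_real t / 2) - of_real pi * (\<i> * of_real t / 2)^2 / of_real t - of_real pi * (\<i> * of_real t / 2) / of_real t = of_real (- pi / 2) * \<i> + of_real (- pi * t / 4)"
      using t by (simp add: field_simps power2_eq_square)
    also have "exp \<dots> = - \<i> * of_real (exp (- pi * t / 4))"
      unfolding exp_add exp_of_real exp_pi_half by simp
    finally have "complex_of_real (?A h ^ 2) = of_real (K * exp (- pi * t / 4) * (2 * ?B (- p) ^ 2))"
      unfolding jA jB by (simp add: mult_ac)
    then show ?thesis by (simp only: of_real_eq_iff)
  qed
  have 3: "?A (- h) ^ 2 = K * exp (pi / (4 * t) - pi * t / 4) * ?B (- k) ^ 2"
  proof -
    let ?w = "1 / 2 + \<i> * of_real t / 2"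
    have e: "exp (2 * of_real pi * ?w / of_real t) = - (1 / of_real k)"
    proof -
      have *: "2 * of_real pi * ?w / of_real t = of_real (pi / t) + of_real pi * \<i>"
        using t by (simp add: field_simps)
      show ?thesis unfolding * exp_add exp_of_real kexp[symmetric] by simp
    qed
    have "exp (2 * of_real pi * \<i> * ?w) = - of_real h"
    proof -
      have *: "2 * of_real pi * \<i> * ?w = of_real (- pi * t) + of_real pi * \<i>"
        by (simp add: algebra_simps)
      show ?thesis unfolding * exp_add exp_of_real h_def by simp
    qed
    then have "jtheta q (- of_real h) = \<i> * of_real K * exp (of_real pi * \<i> * ?w - of_real pi * ?w^2 / of_real t - of_real pi * ?w / of_real t) * jtheta p (- (1 / of_real k))"
      using modular[of ?w, unfolded e] Bpos[of "-k"] k by (simp add: jB)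
    also have "of_real pi * \<i> * ?w - of_real pi * ?w^2 / of_real t - of_real pi * ?w / of_real t = of_real (- pi / 2) * \<i> + of_real (- pi * t / 4 - 3 * pi / (4 * t))"
      using t by (simp add: field_simps power2_eq_square)
    also have "exp \<dots> = - \<i> * of_real (exp (- pi * t / 4 - 3 * pi / (4 * t)))"
      unfolding exp_add exp_of_real exp_pi_half by simp
    finally have "complex_of_real (?A (- h) ^ 2) = of_real (K * (exp (- pi * t / 4 - 3 * pi / (4 * t)) * (1 / k)) * ?B (- k) ^ 2)"
      unfolding jA jB by (simp add: mult_ac)
    then have "?A (- h) ^ 2 = K * (exp (- pi * t / 4 - 3 * pi / (4 * t)) * (1 / k)) * ?B (- k) ^ 2"
      by (simp only: of_real_eq_iff)
    also have "exp (- pi * t / 4 - 3 * pi / (4 * t)) * (1 / k) = exp (pi / (4 * t) - pi * t / 4)"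
      unfolding kexp exp_add[symmetric] using t by (simp add: field_simps)
    finally show ?thesis .
  qed
  have euler_A: "?A h * ?A (- h) * ?A (- q) = 1"
    using qpoch_euler[OF h] by (simp add: qh qpoch_of_real_eq[OF q[unfolded qh]] flip: of_real_minus of_real_power of_real_mult)
  have euler_B: "?B k * ?B (- k) * ?B (- p) = 1"
    using qpoch_euler[OF k] by (simp add: pk qpoch_of_real_eq[OF p[unfolded pk]] flip: of_real_minus of_real_power of_real_mult)
  have "2 * (?A h * ?A (- h) * ?A (- q)) ^ 2 = 2 * ?A (- q) ^ 2 * ?A h ^ 2 * ?A (- h) ^ 2"
    by (simp add: power_mult_distrib mult_ac)
  also have "\<dots> = 2 * K ^ 3 * (exp (pi / (4 * t)) * exp (- pi * t / 4) * exp (pi / (4 * t) - pi * t / 4)) * (?B k * ?B (- k) * ?B (- p)) ^ 2"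
    unfolding 1 2 3 by (simp add: power_mult_distrib power2_eq_square power3_eq_cube mult_ac)
  finally have "K ^ 3 * exp (pi / (2 * t) - pi * t / 2) = 1"
    by (simp add: euler_A euler_B flip: exp_add)
  then have "K ^ 3 = inverse (exp (pi / (2 * t) - pi * t / 2))"
    by (metis inverse_unique mult.commute)
  also have "\<dots> = exp (pi * t / 2 - pi / (2 * t))"
    by (simp flip: exp_minus)
  also have "exp (pi * t / 2 - pi / (2 * t)) = exp (pi * t / 6 - pi / (6 * t)) ^ 3"
    by (simp add: exp_of_nat_mult[symmetric])
  \<comment> \<open>\<open>K\<close> is real and nonnegative, so its cube root is
    unambiguous.\<close>
  finally have "K = exp (pi * t / 6 - pi / (6 * t))"
    by (subst (asm) power_eq_iff_eq_base) (use t in \<open>auto simp: K_def\<close>)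
  then have "(qpoch_real q q / qpoch_real p p) ^ 2 = (exp (pi * t / 12 - pi / (12 * t)) / sqrt t) ^ 2"
    using t by (simp add: K_def power_divide field_simps flip: exp_of_nat_mult)
  then have "qpoch_real q q / qpoch_real p p = exp (pi * t / 12 - pi / (12 * t)) / sqrt t"
    using qpoch_real_pos[OF q q(2)] qpoch_real_pos[OF p p(2)] t by (subst (asm) power2_eq_iff_nonneg) auto
  then show ?thesis
    using qpoch_real_pos[OF p p(2)] by (simp add: field_simps)
qed


text \<open>With \<open>p = k^2\<close> this is
  \<open>(1 + y) * jtheta p (- (k * y)) / jtheta p (- y)\<close>: the dual theta quotient without
  the factor that produces the hyperbolic cosine. For fixed \<open>y\<close> all four products tend
  to 1 as \<open>k\<close> tends to 0.\<close>

definition theta_corr :: "real \<Rightarrow> real \<Rightarrow> real" where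
  "theta_corr k y = (qpoch_real (k^2) (- (k * y)) * qpoch_real (k^2) (- (k / y))) /
                    (qpoch_real (k^2) (- (k^2 * y)) * qpoch_real (k^2) (- (k^2 / y)))"

text \<open>The left side is the generating function for \<open>m = 1\<close> on the unit circle.
  Denominator and numerator correspond to \<open>w = a\<close> and \<open>w = a + 1/2\<close> in the
  inversion, so the common factor \<open>K * exp (e a)\<close> drops out.\<close>

lemma jtheta_quotient:
  fixes t x :: real
  assumes t: "t > 0"
  defines "q \<equiv> exp (-2 * pi * t)" and "h \<equiv> exp (- pi * t)" and "\<zeta> \<equiv> exp (2 * pi * \<i> * x)"
  shows "jtheta q (- (\<zeta> * h)) / jtheta q (\<zeta> * h) =
           of_real (exp (pi / (4 * t)) / (2 * cosh (pi * x / t)) *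
                    theta_corr (exp (- pi / t)) (exp (2 * pi * x / t)))"
proof -
  define p where "p = exp (-2 * pi / t)"
  define k where "k = exp (- pi / t)"
  define y where "y = exp (2 * pi * x / t)"
  have q: "0 < q" "q < 1" and p: "0 < p" "p < 1" and h: "0 < h" "h < 1" and k: "0 < k" "k < 1"
    and y: "y > 0"
    using t by (auto simp: q_def p_def h_def k_def y_def)
  have pk: "p = k^2" by (simp add: p_def k_def exp_double[symmetric])
  define K where "K = \<i> * of_real t * (qpoch q (of_real q) / qpoch p (of_real p)) ^ 2"
  have K: "K \<noteq> 0" using t qpoch_nonzero[OF q, of q] qpoch_nonzero[OF p, of p] q p by (simp add: K_def)
  define a where "a = of_real x + \<i> * of_real t / 2"
  define e where "e = (\<lambda>w. of_real pi * \<i> * w - of_real pi * w^2 / of_real t - of_real pi * w / of_real t)"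
  have modular: "jtheta p (exp (2 * of_real pi * w / of_real t)) \<noteq> 0 \<Longrightarrow> jtheta q (exp (2 * of_real pi * \<i> * w)) =
     K * exp (e w) * jtheta p (exp (2 * of_real pi * w / of_real t))" for w
    using jtheta_modular[OF t, of w] unfolding q_def[symmetric] p_def[symmetric] by (simp add: K_def e_def)
  let ?B = "qpoch_real p"
  have Bpos: "?B z > 0" if "z < 1" for z using qpoch_real_pos[OF p that] .
  have B: "qpoch p (of_real z) = of_real (?B z)" for z by (rule qpoch_of_real_eq[OF p])
  have jD: "jtheta p (- of_real y) = of_real ((1 + y) * ?B (- (p * y)) * ?B (- (p / y)))"
    unfolding jtheta_eq[OF p] using B[of "- (p * y)"] B[of "- (p / y)"] by simp
  have jN: "jtheta p (- of_real (k * y)) = of_real (?B (- (k * y)) * ?B (- (k / y)))"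
  proof -
    have "of_real p / (- of_real (k * y)) = - complex_of_real (k / y)"
      using k y by (simp add: pk power2_eq_square field_simps)
    then show ?thesis
      unfolding jtheta_def using B[of "- (k * y)"] B[of "- (k / y)"] by simp
  qed
  \<comment> \<open>The point \<open>a + 1/2\<close> leads to \<open>- y / k\<close>; one shift by
    \<open>p = k^2\<close> moves it to \<open>- k * y\<close>, where the two products are symmetric
    under \<open>y\<close> to \<open>1 / y\<close>.\<close>
  have jN': "jtheta p (- of_real (y / k)) = of_real (y / k * (?B (- (k * y)) * ?B (- (k / y))))"
  proof -
    have "- of_real (k * y) / of_real p = - complex_of_real (y / k)"
      using k y by (simp add: pk power2_eq_square field_simps)
    then have "jtheta p (- of_real (y / k)) = of_real (y / k) * jtheta p (- of_real (k * y))"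
      using jtheta_shift'[OF p, of "- of_real (k * y)"] k y by simp
    then show ?thesis using jN by (simp only: of_real_mult)
  qed
  have pos: "p * y > 0" "p / y > 0" "k * y > 0" "k / y > 0" using p k y by auto
  have posD: "(1 + y) * ?B (- (p * y)) * ?B (- (p / y)) > 0"
    using y pos by (intro mult_pos_pos Bpos add_pos_pos) linarith+
  have posN: "y / k * (?B (- (k * y)) * ?B (- (k / y))) > 0"
    using y k pos by (intro mult_pos_pos Bpos divide_pos_pos) linarith+
  have kexp: "exp (pi / t) = 1 / k" by (simp add: k_def exp_minus field_simps)
  have v1: "exp (2 * of_real pi * a / of_real t) = - of_real y"
  proof -
    have *: "2 * of_real pi * a / of_real t = of_real (2 * pi * x / t) + of_real pi * \<i>"
      using t by (simp add: a_def field_simps)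
    show ?thesis unfolding * exp_add exp_of_real y_def by simp
  qed
  have v2: "exp (2 * of_real pi * (a + 1/2) / of_real t) = - of_real (y / k)"
  proof -
    have *: "2 * of_real pi * (a + 1/2) / of_real t = of_real (2 * pi * x / t) + of_real (pi / t) + of_real pi * \<i>"
      using t by (simp add: a_def field_simps)
    show ?thesis unfolding * exp_add exp_of_real kexp y_def by simp
  qed
  have u1: "exp (2 * of_real pi * \<i> * a) = \<zeta> * of_real h"
  proof -
    have *: "2 * of_real pi * \<i> * a = 2 * of_real pi * \<i> * of_real x + of_real (- pi * t)"
      by (simp add: a_def algebra_simps)
    show ?thesis unfolding * exp_add exp_of_real by (simp add: \<zeta>_def h_def)
  qed
  have u2: "exp (2 * of_real pi * \<i> * (a + 1/2)) = - (\<zeta> * of_real h)"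
  proof -
    have *: "2 * of_real pi * \<i> * (a + 1/2) = 2 * of_real pi * \<i> * a + of_real pi * \<i>"
      by (simp add: algebra_simps)
    show ?thesis unfolding * exp_add u1 by simp
  qed
  have e: "e (a + 1/2) = e a + of_real (- pi * x / t - 3 * pi / (4 * t))"
    unfolding e_def a_def using t by (simp add: field_simps power2_eq_square)
  have D: "jtheta q (\<zeta> * of_real h) = K * exp (e a) * of_real ((1 + y) * ?B (- (p * y)) * ?B (- (p / y)))"
  proof -
    have "jtheta p (- of_real y) \<noteq> 0"
      unfolding jD of_real_eq_0_iff using posD by (rule less_imp_neq[symmetric])
    from modular[of a, unfolded v1 u1, OF this] show ?thesis unfolding jD .
  qed
  have N: "jtheta q (- (\<zeta> * of_real h)) = K * exp (e a) * of_real (exp (- pi * x / t - 3 * pi / (4 * t)) * (y / k * (?B (- (k * y)) * ?B (- (k / y)))))"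
  proof -
    have "jtheta p (- of_real (y / k)) \<noteq> 0"
      unfolding jN' of_real_eq_0_iff using posN by (rule less_imp_neq[symmetric])
    from modular[of "a + 1/2", unfolded v2 u2, OF this] show ?thesis
      unfolding jN' e exp_add exp_of_real of_real_mult by (simp only: mult.assoc)
  qed
  have "jtheta q (- (\<zeta> * of_real h)) / jtheta q (\<zeta> * of_real h) =
      of_real ((exp (- pi * x / t - 3 * pi / (4 * t)) * (y / k * (?B (- (k * y)) * ?B (- (k / y))))) / ((1 + y) * ?B (- (p * y)) * ?B (- (p / y))))"
    unfolding D N of_real_divide by (rule mult_divide_mult_cancel_left) (use K in simp)
  also have "(exp (- pi * x / t - 3 * pi / (4 * t)) * (y / k * (?B (- (k * y)) * ?B (- (k / y))))) / ((1 + y) * ?B (- (p * y)) * ?B (- (p / y)))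
     = (exp (- pi * x / t - 3 * pi / (4 * t)) * (y / k) / (1 + y)) * theta_corr k y"
    by (simp add: theta_corr_def pk)
  also have "exp (- pi * x / t - 3 * pi / (4 * t)) * (y / k) = exp (pi / (4 * t)) * exp (pi * x / t)"
  proof -
    have "y / k = y * exp (pi / t)" by (simp add: kexp)
    then show ?thesis
      unfolding y_def using t by (simp add: exp_add[symmetric] field_simps)
  qed
  \<comment> \<open>The factor isolated by \<open>jtheta_eq\<close> is the source of the hyperbolic
    cosine; its exponential cancels the one in the numerator.\<close>
  also have "1 + y = exp (pi * x / t) * (2 * cosh (pi * x / t))"
    unfolding y_def cosh_def by (simp add: exp_add[symmetric] distrib_left)
  also have "exp (pi / (4 * t)) * exp (pi * x / t) / (exp (pi * x / t) * (2 * cosh (pi * x / t))) = exp (pi / (4 * t)) / (2 * cosh (pi * x / t))"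
    by simp
  finally show ?thesis by (simp add: k_def y_def)
qed

text \<open>Each of the four products lies between 1 and \<open>exp (2 * z)\<close>, since
  \<open>1 - k^2 \<ge> 1/2\<close>. The numerator alone gives the upper bound and the denominator
  alone the lower one; \<open>k^2 \<le> k\<close> brings both to the same exponent.\<close>

lemma theta_corr_bounds:
  assumes k: "0 < k" "k^2 \<le> 1/2" and y: "y > 0"
  shows "theta_corr k y \<le> exp (2 * k * (y + 1 / y))" "theta_corr k y \<ge> exp (- (2 * k * (y + 1 / y)))"
proof -
  have p: "0 < k^2" "k^2 < 1" using k by auto
  have k1: "k \<le> 1" using k by (metis one_le_power order.trans not_less_iff_gr_or_eq power2_eq_square linorder_not_le order_less_imp_le p(2))
  have B: "1 \<le> qpoch_real (k^2) (- z) \<and> qpoch_real (k^2) (- z) \<le> exp (2 * z)" if "z \<ge> 0" for z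
  proof -
    have "z / (1 - k^2) \<le> z / (1/2)" using that k by (intro divide_left_mono) auto
    then have "exp (z / (1 - k^2)) \<le> exp (2 * z)" by (simp add: mult.commute)
    then show ?thesis using qpoch_real_neg_bounds[OF p that] by linarith
  qed
  note B1 = B[of "k * y"] and B2 = B[of "k / y"] and B3 = B[of "k^2 * y"] and B4 = B[of "k^2 / y"]
  have "theta_corr k y \<le> (exp (2 * (k * y)) * exp (2 * (k / y))) / (1 * 1)"
    unfolding theta_corr_def using B1 B2 B3 B4 k y
    by (intro frac_le mult_mono mult_nonneg_nonneg) auto
  then show "theta_corr k y \<le> exp (2 * k * (y + 1 / y))"
    by (simp add: exp_add[symmetric] algebra_simps)
  have kk: "k^2 \<le> k" using k k1 by (simp add: power2_eq_square mult_left_le)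
  have "exp (- (2 * k * (y + 1 / y))) \<le> exp (- (2 * (k^2 * y) + 2 * (k^2 / y)))"
  proof -
    have "k^2 * (y + 1 / y) \<le> k * (y + 1 / y)" using kk y by (intro mult_right_mono) auto
    moreover have "2 * (k^2 * y) + 2 * (k^2 / y) = 2 * (k^2 * (y + 1 / y))"
      by (simp add: distrib_left)
    ultimately show ?thesis by (simp only: mult.assoc exp_le_cancel_iff)
  qed
  also have "\<dots> = 1 * 1 / (exp (2 * (k^2 * y)) * exp (2 * (k^2 / y)))"
    unfolding exp_minus exp_add by (simp add: divide_inverse)
  also have "\<dots> \<le> theta_corr k y"
  proof -
    have "0 < qpoch_real (k^2) (- (k^2 * y))" "0 < qpoch_real (k^2) (- (k^2 / y))"
      using B3 B4 y by (simp_all add: less_le_trans[OF zero_less_one])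
    then show ?thesis
      unfolding theta_corr_def using B1 B2 B3 B4 k y
      by (intro frac_le mult_mono mult_nonneg_nonneg mult_pos_pos) auto
  qed
  finally show "theta_corr k y \<ge> exp (- (2 * k * (y + 1 / y)))" .
qed

section \<open>Laurent coefficients of the generating function\<close>

text \<open>The generating function has the shape
  \<open>\<alpha> \<zeta> * \<alpha> (1 / \<zeta>)\<close> with one power series
  \<open>\<alpha>\<close>. On the annulus the double series converges absolutely, so it may be
  regrouped along the lines \<open>j - l = s\<close>.\<close>

lemma laurent_of_power_series_product:
  fixes a :: "nat \<Rightarrow> complex" and \<alpha> :: "complex \<Rightarrow> complex"
  assumes sums: "\<And>z. norm z < R \<Longrightarrow> (\<lambda>n. a n * z ^ n) sums \<alpha> z"
  shows "\<exists>c :: int \<Rightarrow> complex. \<forall>\<zeta>. 1 / R < norm \<zeta> \<and> norm \<zeta> < R \<longrightarrow>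
           ((\<lambda>s. c s * \<zeta> powi s) has_sum \<alpha> \<zeta> * \<alpha> (inverse \<zeta>)) UNIV"
proof -
  define D where "D = (\<lambda>s. {(j, l). int j - int l = s})"
  define c where "c = (\<lambda>s. \<Sum>\<^sub>\<infinity>(j, l)\<in>D s. a j * a l)"
  have abs: "(\<lambda>n. norm (a n * z ^ n)) summable_on UNIV" and hs: "((\<lambda>n. a n * z ^ n) has_sum \<alpha> z) UNIV"
    if zR: "norm z < R" for z
  proof -
    obtain r where r: "norm z < r" "r < R" using dense[OF zR] by blast
    then have "summable (\<lambda>n. a n * of_real r ^ n)"
      using sums[of "of_real r"] norm_ge_zero[of z] by (auto simp: sums_iff)
    then have "summable (\<lambda>n. norm (a n * z ^ n))"
      using r by (rule_tac powser_insidea) auto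
    then show "(\<lambda>n. norm (a n * z ^ n)) summable_on UNIV"
              "((\<lambda>n. a n * z ^ n) has_sum \<alpha> z) UNIV"
      using sums[OF zR] by (auto intro!: norm_summable_imp_has_sum norm_summable_imp_summable_on)
  qed
  have "((\<lambda>s. c s * \<zeta> powi s) has_sum \<alpha> \<zeta> * \<alpha> (inverse \<zeta>)) UNIV"
    if \<zeta>: "1 / R < norm \<zeta>" "norm \<zeta> < R" for \<zeta>
  proof -
    have R: "R > 0" using \<zeta>(2) norm_ge_zero[of \<zeta>] by linarith
    then have nz: "\<zeta> \<noteq> 0" using \<zeta>(1) by auto
    have inv: "norm (inverse \<zeta>) < R"
    proof -
      have "1 / norm \<zeta> < R" using \<zeta>(1) nz R by (simp add: field_simps)
      then show ?thesis by (simp add: norm_inverse divide_inverse)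
    qed
    define F where "F = (\<lambda>(j, l). (a j * \<zeta> ^ j) * (a l * inverse \<zeta> ^ l))"
    have "(\<lambda>x. norm (F x)) summable_on UNIV \<times> UNIV"
    proof (rule Infinite_Sum.abs_summable_on_Sigma_iff[THEN iffD2], intro conjI ballI)
      show "(\<lambda>y. norm (F (x, y))) summable_on UNIV" for x
        unfolding F_def prod.case norm_mult[of "a x * \<zeta> ^ x"]
        by (intro summable_on_cmult_right abs[OF inv])
      show "(\<lambda>x. norm (\<Sum>\<^sub>\<infinity>y. norm (F (x, y)))) summable_on UNIV"
        unfolding F_def prod.case norm_mult[of "a _ * \<zeta> ^ _"] infsum_cmult_right' norm_mult[where 'a = real]
        using abs[OF \<zeta>(2)] by (intro summable_on_cmult_left) auto
    qed
    then have Fs: "F summable_on UNIV \<times> UNIV"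
      by (rule Infinite_Sum.abs_summable_summable)
    then have "(F has_sum \<alpha> \<zeta> * \<alpha> (inverse \<zeta>)) (UNIV \<times> UNIV)"
    proof (intro has_sum_SigmaI)
      show "((\<lambda>y. F (x, y)) has_sum (a x * \<zeta> ^ x) * \<alpha> (inverse \<zeta>)) UNIV" for x
        unfolding F_def by (auto intro!: has_sum_cmult_right hs inv)
      show "((\<lambda>x. a x * \<zeta> ^ x * \<alpha> (inverse \<zeta>)) has_sum \<alpha> \<zeta> * \<alpha> (inverse \<zeta>)) UNIV"
        by (intro has_sum_cmult_left hs \<zeta>)
    qed auto
    also have "?this \<longleftrightarrow> ((\<lambda>(s, jl). F jl) has_sum \<alpha> \<zeta> * \<alpha> (inverse \<zeta>)) (Sigma UNIV D)"
      by (rule has_sum_reindex_bij_witness[of _ snd "\<lambda>(j, l). (int j - int l, (j, l))"])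
         (auto simp: D_def)
    finally have hs2: "((\<lambda>(s, jl). F jl) has_sum \<alpha> \<zeta> * \<alpha> (inverse \<zeta>)) (Sigma UNIV D)" .
    have F: "F (j, l) = \<zeta> powi s * (a j * a l)" if "(j, l) \<in> D s" for j l s
    proof -
      have "\<zeta> powi s = \<zeta> ^ j * inverse \<zeta> ^ l"
        using that nz by (auto simp: D_def power_int_diff divide_inverse power_inverse)
      then show ?thesis by (simp add: F_def)
    qed
    have "(F has_sum (c s * \<zeta> powi s)) (D s)" for s
    proof -
      have "F summable_on D s"
        using Fs by (rule summable_on_subset_banach) auto
      then have "(F has_sum infsum F (D s)) (D s)" by simp
      also have "infsum F (D s) = (\<Sum>\<^sub>\<infinity>jl\<in>D s. \<zeta> powi s * (case jl of (j, l) \<Rightarrow> a j * a l))"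
        by (rule infsum_cong) (use F in auto)
      also have "\<dots> = c s * \<zeta> powi s"
        by (subst infsum_cmult_right') (simp add: c_def case_prod_unfold)
      finally show ?thesis .
    qed
    then show ?thesis
      by (intro has_sum_SigmaD[OF hs2]) auto
  qed
  then show ?thesis by blast
qed

text \<open>Unordered summability at \<open>x = 0\<close> already means absolute summability of
  \<open>c\<close>. The M-test then gives uniform convergence on the unit circle, which allows
  termwise integration.\<close>

lemma laurent_coeff_has_integral:
  fixes c :: "int \<Rightarrow> complex" and f :: "real \<Rightarrow> complex"
  assumes hs: "\<And>x. ((\<lambda>s. c s * exp (2 * of_real pi * \<i> * of_real x) powi s) has_sum f x) UNIV"
  shows "((\<lambda>x. f x * exp (- (2 * of_real pi * \<i> * of_int r * of_real x))) has_integral c r) {-1/2..1/2}"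
proof -
  define e where "e = (\<lambda>(s::int) (x::real). exp (2 * of_real pi * \<i> * of_int s * of_real x))"
  define F where "F = (\<lambda>s x. c s * e (s - r) x)"
  have e_powi: "exp (2 * of_real pi * \<i> * of_real x) powi s = e s x" for s x
    unfolding e_def exp_power_int by (simp add: mult_ac)
  have e_add: "e (s - r) x = e s x * exp (- (2 * of_real pi * \<i> * of_int r * of_real x))" for s x
    unfolding e_def exp_add[symmetric] by (simp add: algebra_simps)
  have "c summable_on UNIV"
    using hs[of 0] by (auto simp: summable_on_def)
  then have "(\<lambda>s. norm (c s)) summable_on UNIV"
    by (simp add: summable_on_iff_abs_summable_on_complex)
  then have ul: "uniform_limit {-1/2..1/2} (\<lambda>X x. \<Sum>s\<in>X. F s x) (\<lambda>x. \<Sum>\<^sub>\<infinity>s\<in>UNIV. F s x) (finite_subsets_at_top UNIV)"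
    by (intro Weierstrass_m_test_general[where M = "\<lambda>s. norm (c s)"]) (auto simp: F_def e_def norm_mult)
  have inf: "(\<Sum>\<^sub>\<infinity>s\<in>UNIV. F s x) = f x * exp (- (2 * of_real pi * \<i> * of_int r * of_real x))" for x
    unfolding F_def e_add mult.assoc[symmetric]
    by (intro infsumI has_sum_cmult_left) (use hs[of x] in \<open>simp add: e_powi\<close>)
  have e_int: "(e s has_integral (if s = 0 then 1 else 0)) {-1/2..1/2}" for s
  proof (cases "s = 0")
    case True
    then show ?thesis
      using has_integral_const_real[of "1::complex" "-1/2" "1/2"] by (simp add: e_def)
  next
    case False
    define k where "k = 2 * of_real pi * \<i> * complex_of_int s"
    have k: "k \<noteq> 0" using False by (simp add: k_def)
    have "(e s has_integral (exp (k * of_real (1/2)) / k - exp (k * of_real (-1/2)) / k)) {-1/2..1/2}"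
    proof (rule fundamental_theorem_of_calculus)
      fix x :: real
      have "((\<lambda>z. exp (k * z) / k) has_field_derivative exp (k * of_real x)) (at (of_real x))"
        using k by (auto intro!: derivative_eq_intros)
      from has_vector_derivative_real_field[OF this]
      show "((\<lambda>x. exp (k * of_real x) / k) has_vector_derivative e s x) (at x within {-1/2..1/2})"
        by (simp add: e_def k_def mult_ac)
    qed auto
    also have "exp (k * of_real (1/2)) = exp (k * of_real (-1/2) + 2 * of_int s * of_real pi * \<i>)"
      by (simp add: k_def algebra_simps)
    also have "\<dots> = exp (k * of_real (-1/2))"
      unfolding exp_add by (simp add: exp_eq_1 mult_ac) 
    finally show ?thesis using False by simp
  qed
  obtain I J where IJ: "\<And>X. ((\<lambda>x. \<Sum>s\<in>X. F s x) has_integral I X) {-1/2..1/2}"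
      "((\<lambda>x. \<Sum>\<^sub>\<infinity>s\<in>UNIV. F s x) has_integral J) {-1/2..1/2}" "(I \<longlongrightarrow> J) (finite_subsets_at_top UNIV)"
    by (rule uniform_limit_integral[OF ul]) (auto simp: F_def e_def intro!: continuous_intros)
  \<comment> \<open>By orthogonality every finite partial sum containing the index \<open>r\<close>
    integrates to exactly \<open>c r\<close>, so the net of integrals is eventually
    constant.\<close>
  have "I X = c r" if "finite X" "r \<in> X" for X
  proof -
    have "((\<lambda>x. \<Sum>s\<in>X. F s x) has_integral (\<Sum>s\<in>X. c s * (if s - r = 0 then 1 else 0))) {-1/2..1/2}"
      unfolding F_def by (intro has_integral_sum that has_integral_mult_right e_int)
    also have "(\<Sum>s\<in>X. c s * (if s - r = 0 then 1 else 0)) = c r"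
      using that by (simp add: if_distrib cong: if_cong)
    finally show ?thesis by (rule has_integral_unique[OF IJ(1)])
  qed
  then have "\<forall>\<^sub>F X in finite_subsets_at_top UNIV. I X = c r"
    unfolding eventually_finite_subsets_at_top by (intro exI[of _ "{r}"]) auto
  then have "(I \<longlongrightarrow> c r) (finite_subsets_at_top UNIV)"
    by (rule tendsto_eventually)
  then have "J = c r"
    using IJ(3) by (intro tendsto_unique[of "finite_subsets_at_top UNIV" I]) auto
  then show ?thesis using IJ(2) by (simp add: inf)
qed

section \<open>The generating function on the imaginary axis\<close>

lemma qpow_imaginary: "qpow (\<i> * of_real t) x = of_real (exp (- 2 * pi * t * x))"
proof -
  have "2 * of_real pi * \<i> * (\<i> * of_real t) * of_real x = of_real (- 2 * pi * t * x)"
    by (simp add: algebra_simps)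
  then show ?thesis unfolding qpow_def by (simp only: exp_of_real)
qed

lemma laurent_annulus_imaginary:
  "laurent_annulus (\<i> * of_real t) = {\<zeta>. exp (- pi * t) < cmod \<zeta> \<and> cmod \<zeta> < 1 / exp (- pi * t)}"
proof -
  have 1: "cmod (qpow (\<i> * of_real t) 1) = exp (- 2 * pi * t)"
    unfolding qpow_imaginary norm_of_real by simp
  have 2: "exp (- 2 * pi * t * (-1/2)) = 1 / exp (- pi * t)"
    by (simp add: exp_minus inverse_eq_divide)
  show ?thesis
    unfolding laurent_annulus_def 1 exp_powr_real 2 by simp
qed

lemma chF_generating_imaginary:
  fixes t :: real
  assumes t: "t > 0" and \<zeta>: "\<zeta> \<in> laurent_annulus (\<i> * of_real t)"
  defines "q \<equiv> exp (-2 * pi * t)" and "h \<equiv> exp (- pi * t)"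
  shows "chF_generating m (\<i> * of_real t) \<zeta> =
           (qpoch q (- (\<zeta> * h)) / qpoch q (\<zeta> * h)) ^ m *
           (qpoch q (- (inverse \<zeta> * h)) / qpoch q (inverse \<zeta> * h)) ^ m"
proof -
  have q: "0 < q" "q < 1" and h: "0 < h" using t by (auto simp: q_def h_def)
  have pow: "qpow (\<i> * of_real t) (real k + 1/2) = of_real h * of_real q ^ k" for k
  proof -
    have "exp (- 2 * pi * t * (real k + 1/2)) = h * q ^ k"
      unfolding h_def q_def exp_of_nat_mult[symmetric] exp_add[symmetric] by (simp add: algebra_simps)
    then show ?thesis unfolding qpow_imaginary by simp
  qed
  have P: "(\<lambda>k. (1 - w * of_real q ^ k) ^ m) has_prod (qpoch q w ^ m)" for w
    by (intro has_prod_power qpoch_has_prod q)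
  have "(\<lambda>k. ((1 - (- (\<zeta> * h)) * of_real q ^ k) ^ m * (1 - (- (inverse \<zeta> * h)) * of_real q ^ k) ^ m) /
              ((1 - (\<zeta> * h) * of_real q ^ k) ^ m * (1 - (inverse \<zeta> * h) * of_real q ^ k) ^ m)) has_prod
        ((qpoch q (- (\<zeta> * h)) ^ m * qpoch q (- (inverse \<zeta> * h)) ^ m) /
         (qpoch q (\<zeta> * h) ^ m * qpoch q (inverse \<zeta> * h) ^ m))"
    by (intro has_prod_divide has_prod_mult P)
  then have "(\<lambda>k. ((1 + \<zeta> * qpow (\<i> * of_real t) (real k + 1/2)) ^ m * (1 + inverse \<zeta> * qpow (\<i> * of_real t) (real k + 1/2)) ^ m) /
          ((1 - \<zeta> * qpow (\<i> * of_real t) (real k + 1/2)) ^ m * (1 - inverse \<zeta> * qpow (\<i> * of_real t) (real k + 1/2)) ^ m)) has_prod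
        ((qpoch q (- (\<zeta> * h)) ^ m * qpoch q (- (inverse \<zeta> * h)) ^ m) /
         (qpoch q (\<zeta> * h) ^ m * qpoch q (inverse \<zeta> * h) ^ m))"
    unfolding pow by (simp add: mult_ac)
  from has_prod_unique[OF this] show ?thesis
    unfolding chF_generating_def by (simp add: power_divide)
qed

text \<open>\<open>chF\<close> is a definite description, so a coefficient family must be shown to
  exist and to be unique. Existence comes from the product of two power series; uniqueness holds
  because every admissible family is given by the same Fourier integrals.\<close>

lemma chF_has_integral:
  fixes t :: real
  assumes t: "t > 0"
  shows "((\<lambda>x. of_real ((exp (pi / (4 * t)) / (2 * cosh (pi * x / t)) *
                    theta_corr (exp (- pi / t)) (exp (2 * pi * x / t))) ^ m) *
               exp (- (2 * of_real pi * \<i> * of_int r * of_real x)))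
          has_integral chF m r (\<i> * of_real t)) {-1/2..1/2}"
proof -
  define q where "q = exp (-2 * pi * t)"
  define h where "h = exp (- pi * t)"
  have q: "0 < q" "q < 1" and h: "0 < h" "h < 1" and qh: "q = h * h"
    using t by (auto simp: q_def h_def exp_add[symmetric])
  define \<alpha> where "\<alpha> = (\<lambda>z. (qpoch q (- (z * of_real h)) / qpoch q (z * of_real h)) ^ m)"
  let ?A = "laurent_annulus (\<i> * of_real t)"
  let ?G = "chF_generating m (\<i> * of_real t)"
  have annulus: "\<zeta> \<in> ?A \<longleftrightarrow> 1 / (1 / h) < cmod \<zeta> \<and> cmod \<zeta> < 1 / h" for \<zeta>
    unfolding laurent_annulus_imaginary h_def by simp
  have G: "?G \<zeta> = \<alpha> \<zeta> * \<alpha> (inverse \<zeta>)" if "\<zeta> \<in> ?A" for \<zeta>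
    unfolding \<alpha>_def using chF_generating_imaginary[OF t that, of m, folded q_def h_def] by simp
  \<comment> \<open>The denominator has its first zero at \<open>z = 1 / h\<close>, which is also
    the outer radius of the annulus.\<close>
  have "\<alpha> holomorphic_on ball 0 (1 / h)"
    unfolding \<alpha>_def
  proof (intro holomorphic_intros q)
    fix z :: complex assume "z \<in> ball 0 (1 / h)"
    then have "norm (z * of_real h) < 1" using h by (simp add: norm_mult field_simps)
    then show "qpoch q (z * of_real h) \<noteq> 0" by (rule qpoch_nonzero[OF q])
  qed
  then have "(\<lambda>n. (deriv ^^ n) \<alpha> 0 / fact n * z ^ n) sums \<alpha> z" if "norm z < 1 / h" for z :: complex
    using holomorphic_power_series[of \<alpha> 0 "1 / h" z] that by simp
  from laurent_of_power_series_product[OF this] obtain c where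
    c: "\<And>\<zeta>. \<zeta> \<in> ?A \<Longrightarrow> ((\<lambda>s. c s * \<zeta> powi s) has_sum ?G \<zeta>) UNIV"
    using annulus G by metis
  have unit: "exp (2 * of_real pi * \<i> * of_real x) \<in> ?A" for x :: real
    unfolding annulus using h by (simp add: field_simps)
  have int: "((\<lambda>x. ?G (exp (2 * of_real pi * \<i> * of_real x)) * exp (- (2 * of_real pi * \<i> * of_int r * of_real x)))
      has_integral c' r) {-1/2..1/2}"
    if "\<forall>\<zeta>\<in>?A. ((\<lambda>s. c' s * \<zeta> powi s) has_sum ?G \<zeta>) UNIV" for c' :: "int \<Rightarrow> complex" and r
    by (rule laurent_coeff_has_integral) (use that unit in blast)
  have "chF m r (\<i> * of_real t) = c r"
    unfolding chF_def
  proof (rule arg_cong[where f = "\<lambda>f. f r"], rule the_equality)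
    show "\<forall>\<zeta>\<in>?A. ((\<lambda>s. c s * \<zeta> powi s) has_sum ?G \<zeta>) UNIV" using c by blast
    then show "c' = c" if "\<forall>\<zeta>\<in>?A. ((\<lambda>s. c' s * \<zeta> powi s) has_sum ?G \<zeta>) UNIV" for c'
      using int[OF that] int[of c] has_integral_unique by blast
  qed
  moreover have "?G (exp (2 * of_real pi * \<i> * of_real x)) = of_real ((exp (pi / (4 * t)) / (2 * cosh (pi * x / t)) *
                    theta_corr (exp (- pi / t)) (exp (2 * pi * x / t))) ^ m)" for x
  proof -
    let ?\<zeta> = "exp (2 * of_real pi * \<i> * of_real x)"
    have 1: "of_real q / (?\<zeta> * of_real h) = inverse ?\<zeta> * of_real h"
      using h by (simp add: qh field_simps)
    have "?G ?\<zeta> = (jtheta q (- (?\<zeta> * of_real h)) / jtheta q (?\<zeta> * of_real h)) ^ m"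
      unfolding G[OF unit] \<alpha>_def jtheta_def using 1 by (simp add: power_divide power_mult_distrib)
    also have "\<dots> = of_real ((exp (pi / (4 * t)) / (2 * cosh (pi * x / t)) *
                    theta_corr (exp (- pi / t)) (exp (2 * pi * x / t))) ^ m)"
      using jtheta_quotient[OF t, of x, folded q_def h_def] by simp
    finally show ?thesis .
  qed
  ultimately show ?thesis using int[of c r] c by simp
qed

lemma prod_imaginary:
  assumes t: "t > 0"
  shows "(\<Prod>k. 1 - qpow (\<i> * of_real t) 1 ^ Suc k) = of_real (qpoch_real (exp (-2 * pi * t)) (exp (-2 * pi * t)))"
proof -
  have q: "0 < exp (-2 * pi * t)" "exp (-2 * pi * t) < 1" using t by auto
  show ?thesis
    unfolding qpow_imaginary qpoch_of_real_eq[OF q, symmetric] unfolding qpoch_def by (simp add: exp_of_real)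
qed

section \<open>Moments of powers of the hyperbolic secant\<close>

text \<open>The common majorant for the moments. The rate 1 in the exponent, weaker than the true
  rate of the hyperbolic secant, makes the integral a plain factorial.\<close>

lemma has_bochner_integral_abs_power_exp:
  "has_bochner_integral lborel (\<lambda>u::real. \<bar>u\<bar> ^ k * exp (- \<bar>u\<bar>)) (2 * fact k)"
proof -
  have "has_bochner_integral lborel (\<lambda>u::real. indicator {0..} u *\<^sub>R (\<bar>u\<bar> ^ k * exp (- \<bar>u\<bar>))) (fact k)"
    by (rule has_bochner_integral_cong[THEN iffD1, OF _ _ _ has_bochner_integral_I0i_power_exp_m'])
       (auto simp: indicator_def)
  from has_bochner_integral_even_function[OF this] show ?thesis by simp
qed

lemma cosh_pi_ge: "exp \<bar>u\<bar> \<le> 2 * cosh (pi * u)"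
proof -
  have "\<bar>u\<bar> \<le> pi * \<bar>u\<bar>" using pi_ge_two by (simp add: mult_le_cancel_right1)
  then have "exp \<bar>u\<bar> \<le> exp (pi * \<bar>u\<bar>)" by simp
  also have "\<dots> \<le> exp (pi * u) + exp (- (pi * u))"
    by (cases "u \<ge> 0") auto
  finally show ?thesis by (simp add: cosh_def)
qed

lemma inverse_cosh_power_le:
  assumes "n \<ge> 1"
  shows "1 / cosh (pi * u) ^ n \<le> 2 * exp (- \<bar>u\<bar>)"
proof -
  have "cosh (pi * u) ^ 1 \<le> cosh (pi * u) ^ n"
    by (intro power_increasing assms cosh_real_ge_1)
  then have "exp \<bar>u\<bar> / 2 \<le> cosh (pi * u) ^ n"
    using cosh_pi_ge[of u] by simp
  then have "1 / cosh (pi * u) ^ n \<le> 1 / (exp \<bar>u\<bar> / 2)"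
    by (intro divide_left_mono mult_pos_pos zero_less_power) auto
  then show ?thesis by (simp add: exp_minus field_simps)
qed

lemma integrable_power_sech:
  assumes "n \<ge> 1"
  shows "integrable lborel (\<lambda>u::real. u ^ k / cosh (pi * u) ^ n)"
proof (rule Bochner_Integration.integrable_bound)
  show "integrable lborel (\<lambda>u::real. 2 * (\<bar>u\<bar> ^ k * exp (- \<bar>u\<bar>)))"
    using has_bochner_integral_abs_power_exp[of k] by (auto simp: has_bochner_integral_iff)
  have "\<bar>u ^ k / cosh (pi * u) ^ n\<bar> \<le> 2 * (\<bar>u\<bar> ^ k * exp (- \<bar>u\<bar>))" for u
  proof -
    have "\<bar>u ^ k / cosh (pi * u) ^ n\<bar> = \<bar>u\<bar> ^ k * (1 / cosh (pi * u) ^ n)"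
      by (simp add: abs_mult power_abs)
    also have "\<dots> \<le> \<bar>u\<bar> ^ k * (2 * exp (- \<bar>u\<bar>))"
      by (intro mult_left_mono inverse_cosh_power_le assms) auto
    finally show ?thesis by simp
  qed
  then show "AE u in lborel. norm (u ^ k / cosh (pi * u) ^ n) \<le> norm (2 * (\<bar>u\<bar> ^ k * exp (- \<bar>u\<bar>)))"
    by (intro always_eventually) (auto intro: order.trans)
qed (simp add: cosh_def)

definition sech_moment :: "nat \<Rightarrow> nat \<Rightarrow> real" where
  "sech_moment k n = (\<integral>u. u ^ k / cosh (pi * u) ^ n \<partial>lborel)"

lemma integral_deriv_eq_0:
  fixes F f :: "real \<Rightarrow> real"
  assumes "\<And>x. (F has_real_derivative f x) (at x)" "continuous_on UNIV f" "integrable lborel f"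
    and "(F \<longlongrightarrow> 0) at_infinity"
  shows "(\<integral>x. f x \<partial>lborel) = 0"
proof -
  have "(LBINT x=-\<infinity>..\<infinity>. f x) = 0 - 0"
  proof (rule interval_integral_FTC_integrable[where F = F])
    show "(F has_vector_derivative f x) (at x)" for x
      using assms(1) by (simp add: has_real_derivative_iff_has_vector_derivative)
    show "isCont f x" for x
      using assms(2) by (simp add: continuous_on_eq_continuous_at)
    show "set_integrable lborel (einterval (- \<infinity>) \<infinity>) f"
      using assms(3) by (simp add: set_integrable_def)
    show "((F \<circ> real_of_ereal) \<longlongrightarrow> 0) (at_right (-\<infinity>))" "((F \<circ> real_of_ereal) \<longlongrightarrow> 0) (at_left \<infinity>)"
      unfolding ereal_tendsto_simps
      using assms(4) at_top_le_at_infinity at_bot_le_at_infinity filterlim_mono by blast+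
  qed simp
  then show ?thesis
    by (simp add: interval_lebesgue_integral_def set_lebesgue_integral_def)
qed

lemma tendsto_power_sech:
  assumes "n \<ge> 1"
  shows "((\<lambda>u::real. u ^ k / cosh (pi * u) ^ n) \<longlongrightarrow> 0) at_infinity"
proof -
  have "((\<lambda>x::real. 2 * (x ^ k / exp x)) \<longlongrightarrow> 2 * 0) at_top"
    by (intro tendsto_mult tendsto_power_div_exp_0 tendsto_const)
  then have lim: "((\<lambda>u::real. 2 * (norm u ^ k / exp (norm u))) \<longlongrightarrow> 2 * 0) at_infinity"
    by (rule filterlim_compose) (rule filterlim_norm_at_top)
  show ?thesis
  proof (rule Lim_null_comparison)
    have "norm (u ^ k / cosh (pi * u) ^ n) \<le> 2 * (norm u ^ k / exp (norm u))" for u :: real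
    proof -
      have "norm (u ^ k / cosh (pi * u) ^ n) = \<bar>u\<bar> ^ k * (1 / cosh (pi * u) ^ n)"
        by (simp add: abs_mult power_abs)
      also have "\<dots> \<le> \<bar>u\<bar> ^ k * (2 * exp (- \<bar>u\<bar>))"
        by (intro mult_left_mono inverse_cosh_power_le assms) auto
      finally show ?thesis by (simp add: exp_minus divide_inverse mult_ac)
    qed
    then show "\<forall>\<^sub>F u in at_infinity. norm (u ^ k / cosh (pi * u) ^ n) \<le> 2 * (norm u ^ k / exp (norm u))"
      by (intro always_eventually) auto
    show "((\<lambda>u::real. 2 * (norm u ^ k / exp (norm u))) \<longlongrightarrow> 0) at_infinity"
      using lim by simp
  qed
qed

text \<open>Two integrations by parts packed into one antiderivative. With
  \<open>S = 1 / cosh (pi * u) ^ n\<close>, the function \<open>F = u^k S' - k u^(k-1) S\<close>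
  vanishes at infinity and has derivative \<open>f = u^k S'' - k (k - 1) u^(k-2) S\<close>. For
  \<open>k < 2\<close> the truncated exponents do no harm, as their coefficients are 0.\<close>

lemma sech_moment_rec:
  assumes n: "n \<ge> 1"
  shows "sech_moment k (n + 2) = real n / real (n + 1) * sech_moment k n -
           real k * real (k - 1) / (pi ^ 2 * real n * real (n + 1)) * sech_moment (k - 2) n"
proof -
  define F where "F = (\<lambda>u. - (real n * pi) * (u ^ k * sinh (pi * u) / cosh (pi * u) ^ (n + 1))
                            - real k * (u ^ (k - 1) / cosh (pi * u) ^ n))"
  define f where "f = (\<lambda>u. pi^2 * (real n ^ 2 * (u ^ k / cosh (pi * u) ^ n) - real n * real (n + 1) * (u ^ k / cosh (pi * u) ^ (n + 2)))
                            - real k * real (k - 1) * (u ^ (k - 2) / cosh (pi * u) ^ n))"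
  have int: "integrable lborel f"
    unfolding f_def using n by (intro Bochner_Integration.integrable_diff integrable_mult_right integrable_power_sech) auto
  have "(\<integral>u. f u \<partial>lborel) = 0"
  proof (rule integral_deriv_eq_0[OF _ _ int])
    show "continuous_on UNIV f"
      unfolding f_def by (auto intro!: continuous_intros)
    show "(F has_real_derivative f u) (at u)" for u
    proof -
      define v where "v = (\<lambda>u. 1 / cosh (pi * u))"
      define s where "s = (\<lambda>u. sinh (pi * u))"
      have cv: "cosh (pi * u) * v u = 1" by (simp add: v_def)
      have "s u ^ 2 = cosh (pi * u) ^ 2 - 1" by (simp add: s_def sinh_square_eq)
      then have "(s u * v u) ^ 2 = 1 - v u ^ 2"
        by (simp add: v_def power_mult_distrib power_divide diff_divide_distrib)
      then have "(s u * v u) ^ 2 * v u ^ n = (1 - v u ^ 2) * v u ^ n" by simp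
      \<comment> \<open>A consequence of \<open>sinh^2 = cosh^2 - 1\<close>; it splits the second
        derivative into the powers \<open>n\<close> and \<open>n + 2\<close>.\<close>
      then have sv: "s u * s u * v u ^ (n + 2) = v u ^ n - v u ^ (n + 2)"
        by (simp add: power_add power2_eq_square algebra_simps)
      have ds: "(s has_real_derivative pi * cosh (pi * u)) (at u)"
        unfolding s_def by (auto intro!: derivative_eq_intros)
      have v': "(v has_real_derivative - pi * s u * v u ^ 2) (at u)"
        unfolding v_def s_def by (auto intro!: derivative_eq_intros simp: power2_eq_square)
      have dv: "((\<lambda>u. v u ^ j) has_real_derivative - real j * pi * s u * v u ^ (j + 1)) (at u)" for j
        by (rule DERIV_cong[OF DERIV_power[OF v', of j]]) (cases j; simp add: power2_eq_square algebra_simps)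
      have km: "u ^ (k - 1 - 1) = u ^ (k - 2)"
        by (simp add: numeral_2_eq_2)
      have dp: "((\<lambda>u. u ^ j) has_real_derivative real j * u ^ (j - 1)) (at u)" for j
        by (rule DERIV_cong[OF DERIV_power[OF DERIV_ident, of j]]) simp
      have "((\<lambda>u. - (real n * pi) * (u ^ k * (s u * v u ^ (n + 1))) - real k * (u ^ (k - 1) * v u ^ n)) has_real_derivative
          - (real n * pi) * (real k * u ^ (k - 1) * (s u * v u ^ (n + 1)) + u ^ k * (pi * cosh (pi * u) * v u ^ (n + 1) + s u * (- real (n + 1) * pi * s u * v u ^ (n + 1 + 1))))
          - real k * (real (k - 1) * u ^ (k - 1 - 1) * v u ^ n + u ^ (k - 1) * (- real n * pi * s u * v u ^ (n + 1)))) (at u)"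
        by (rule DERIV_cong[OF DERIV_diff[OF DERIV_cmult[OF DERIV_mult'[OF dp DERIV_mult'[OF ds dv]]]
                    DERIV_cmult[OF DERIV_mult'[OF dp dv]]]]) (simp add: algebra_simps)
      also have "(\<lambda>u. - (real n * pi) * (u ^ k * (s u * v u ^ (n + 1))) - real k * (u ^ (k - 1) * v u ^ n)) = F"
        by (simp add: F_def fun_eq_iff s_def v_def power_divide)
      also have "pi * cosh (pi * u) * v u ^ (n + 1) = pi * v u ^ n"
        using cv by (simp add: mult_ac)
      also have "s u * (- real (n + 1) * pi * s u * v u ^ (n + 1 + 1)) = - real (n + 1) * pi * (s u * s u * v u ^ (n + 2))"
        by (simp add: mult_ac)
      also note sv
      also have "- (real n * pi) * (real k * u ^ (k - 1) * (s u * v u ^ (n + 1)) + u ^ k * (pi * v u ^ n + - real (n + 1) * pi * (v u ^ n - v u ^ (n + 2))))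
          - real k * (real (k - 1) * u ^ (k - 1 - 1) * v u ^ n + u ^ (k - 1) * (- real n * pi * s u * v u ^ (n + 1))) = 
         pi^2 * (real n ^ 2 * (u ^ k * v u ^ n) - real n * real (n + 1) * (u ^ k * v u ^ (n + 2)))
                            - real k * real (k - 1) * (u ^ (k - 2) * v u ^ n)"
        unfolding km by (simp add: algebra_simps power2_eq_square)
      also have "\<dots> = f u"
        by (simp add: f_def v_def power_divide)
      finally show ?thesis .
    qed
    have "((\<lambda>u. u ^ k * sinh (pi * u) / cosh (pi * u) ^ (n + 1)) \<longlongrightarrow> 0) at_infinity"
    proof (rule Lim_null_comparison)
      have "norm (u ^ k * sinh (pi * u) / cosh (pi * u) ^ (n + 1)) \<le> norm (u ^ k / cosh (pi * u) ^ n)" for u :: real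
      proof -
        have "\<bar>sinh (pi * u)\<bar> \<le> cosh (pi * u)"
          using sinh_less_cosh_real[of "pi * u"] sinh_less_cosh_real[of "- (pi * u)"]
          by (simp add: abs_le_iff)
        then have "\<bar>sinh (pi * u)\<bar> / cosh (pi * u) \<le> 1" by simp
        then have "norm (u ^ k / cosh (pi * u) ^ n) * (\<bar>sinh (pi * u)\<bar> / cosh (pi * u)) \<le> norm (u ^ k / cosh (pi * u) ^ n) * 1"
          by (intro mult_left_mono) auto
        then show ?thesis by (simp add: abs_mult mult_ac)
      qed
      then show "\<forall>\<^sub>F u in at_infinity. norm (u ^ k * sinh (pi * u) / cosh (pi * u) ^ (n + 1)) \<le> norm (u ^ k / cosh (pi * u) ^ n)"
        by (intro always_eventually) auto
      show "((\<lambda>u::real. norm (u ^ k / cosh (pi * u) ^ n)) \<longlongrightarrow> 0) at_infinity"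
        using tendsto_power_sech[OF n] by (rule tendsto_norm_zero)
    qed
    then have "(F \<longlongrightarrow> - (real n * pi) * 0 - real k * 0) at_infinity"
      unfolding F_def by (intro tendsto_intros tendsto_power_sech n)
    then show "(F \<longlongrightarrow> 0) at_infinity" by simp
  qed
  also have "(\<integral>u. f u \<partial>lborel) = pi^2 * (real n ^ 2 * sech_moment k n - real n * real (n + 1) * sech_moment k (n + 2))
              - real k * real (k - 1) * sech_moment (k - 2) n"
  proof -
    have *: "has_bochner_integral lborel (\<lambda>u. u ^ i / cosh (pi * u) ^ j) (sech_moment i j)" if "j \<ge> 1" for i j
      unfolding sech_moment_def using integrable_power_sech[OF that]
      by (rule has_bochner_integral_integrable)
    show ?thesis
      unfolding f_def using n
      by (intro has_bochner_integral_integral_eq has_bochner_integral_diff has_bochner_integral_mult_right *) auto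
  qed
  finally have eq: "pi^2 * real n * real (n + 1) * sech_moment k (n + 2) =
      pi^2 * real n ^ 2 * sech_moment k n - real k * real (k - 1) * sech_moment (k - 2) n"
    by (simp add: algebra_simps)
  have nz: "pi^2 * real n * real (n + 1) \<noteq> 0" using n by simp
  then have "sech_moment k (n + 2) = (pi^2 * real n ^ 2 * sech_moment k n -
      real k * real (k - 1) * sech_moment (k - 2) n) / (pi^2 * real n * real (n + 1))"
    unfolding eq[symmetric] by (simp del: of_nat_add of_nat_Suc)
  also note diff_divide_distrib
  also have "pi^2 * real n ^ 2 * sech_moment k n / (pi^2 * real n * real (n + 1)) = real n / real (n + 1) * sech_moment k n"
    using n by (simp add: power2_eq_square)
  finally show ?thesis by simp
qed

section \<open>The moments for \<open>n = 2\<close> and the Bernoulli polynomials at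
  \<open>1/2\<close>\<close>

lemma Gamma_real_reflection_shift:
  fixes a :: real
  assumes a: "0 < a" "a < 1"
  shows "Gamma (1 + a) * Gamma (1 - a) = pi * a / sin (pi * a)"
proof -
  have "complex_of_real (Gamma a * Gamma (1 - a)) = of_real (pi / sin (pi * a))"
    using Gamma_reflection_complex[of "of_real a"] Gamma_complex_of_real[of a] Gamma_complex_of_real[of "1 - a"]
    by (simp flip: of_real_mult sin_of_real)
  then have "Gamma a * Gamma (1 - a) = pi / sin (pi * a)" by (simp only: of_real_eq_iff)
  moreover have "a \<notin> \<int>\<^sub>\<le>\<^sub>0" using a by (auto elim!: nonpos_Ints_cases)
  then have "Gamma (1 + a) = a * Gamma a"
    using Gamma_plus1[of a] a by (simp add: add.commute)
  ultimately show ?thesis by (simp add: mult.assoc)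
qed

text \<open>The squared secant is at most \<open>4 * exp (- 2 * \<bar>u\<bar>)\<close>; one factor
  \<open>exp (- \<bar>u\<bar>)\<close> absorbs \<open>exp (s * u)\<close> and the other remains as
  majorant.\<close>

lemma integrable_exp_sech_square:
  assumes "\<bar>s\<bar> \<le> 1"
  shows "integrable lborel (\<lambda>u::real. exp (s * u) / cosh (pi * u) ^ 2)"
proof (rule Bochner_Integration.integrable_bound)
  show "integrable lborel (\<lambda>u::real. 4 * (\<bar>u\<bar> ^ 0 * exp (- \<bar>u\<bar>)))"
    using has_bochner_integral_abs_power_exp[of 0] by (auto simp: has_bochner_integral_iff)
  have "\<bar>exp (s * u) / cosh (pi * u) ^ 2\<bar> \<le> 4 * (\<bar>u\<bar> ^ 0 * exp (- \<bar>u\<bar>))" for u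
  proof -
    have "s * u \<le> \<bar>s\<bar> * \<bar>u\<bar>" by (metis abs_ge_self abs_mult)
    also have "\<dots> \<le> 1 * \<bar>u\<bar>" using assms by (intro mult_right_mono) auto
    finally have 1: "exp (s * u) \<le> exp \<bar>u\<bar>" by simp
    have "1 / cosh (pi * u) ^ 1 \<le> 2 * exp (- \<bar>u\<bar>)" by (rule inverse_cosh_power_le) simp
    then have "(1 / cosh (pi * u)) ^ 2 \<le> (2 * exp (- \<bar>u\<bar>)) ^ 2"
      by (intro power_mono) auto
    with 1 have "exp (s * u) * (1 / cosh (pi * u)) ^ 2 \<le> exp \<bar>u\<bar> * (2 * exp (- \<bar>u\<bar>)) ^ 2"
      by (intro mult_mono) auto
    also have "\<dots> = 4 * exp (- \<bar>u\<bar>)"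
      by (simp add: power2_eq_square mult_ac exp_add[symmetric])
    finally show ?thesis by (simp add: power_divide)
  qed
  then show "AE u in lborel. norm (exp (s * u) / cosh (pi * u) ^ 2) \<le> norm (4 * (\<bar>u\<bar> ^ 0 * exp (- \<bar>u\<bar>)))"
    by (intro always_eventually) (auto intro: order.trans)
qed (simp add: cosh_def)

text \<open>The substitution \<open>x = 1 / (1 + exp (- 2 \<pi> u))\<close> turns the integral into a Beta integral.\<close>
lemma integral_exp_sech_square:
  assumes s: "0 < s" "s < 1"
  shows "(\<integral>u. exp (s * u) / cosh (pi * u) ^ 2 \<partial>lborel) = s / (pi * sin (s / 2))"
proof -
  \<comment> \<open>Under the substitution \<open>x / (1 - x) = exp (2 * pi * u)\<close>, so this
    exponent turns \<open>(x / (1 - x)) powr a\<close> into \<open>exp (s * u)\<close>.\<close>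
  define a where "a = s / (2 * pi)"
  have a: "0 < a" "a < 1" using s pi_ge_two by (auto simp: a_def field_simps)
  define g where "g = (\<lambda>u::real. 1 / (1 + exp (- (2 * pi * u))))"
  define g' where "g' = (\<lambda>u::real. 2 * pi * exp (- (2 * pi * u)) / (1 + exp (- (2 * pi * u))) ^ 2)"
  define f where "f = (\<lambda>x::real. x powr a * (1 - x) powr (- a))"
  have pos: "1 + exp x > 0" for x :: real by (simp add: add_pos_pos)
  have g: "0 < g u" "g u < 1" for u
    using pos[of "- (2 * pi * u)"] by (auto simp: g_def field_simps)
  have fg: "f (g u) * g' u = pi / 2 * (exp (s * u) / cosh (pi * u) ^ 2)" for u
  proof -
    define E where "E = exp (- (2 * pi * u))"
    have E: "E > 0" by (simp add: E_def)
    have "1 - g u = E * g u" unfolding g_def E_def[symmetric] using E by (simp add: field_simps)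
    then have "f (g u) = g u powr a * (E powr (- a) * g u powr (- a))"
      using g[of u] E by (simp add: f_def powr_mult)
    also have "\<dots> = E powr (- a)" using g[of u] by (simp add: powr_minus field_simps)
    also have "\<dots> = exp (s * u)" by (simp add: E_def powr_def a_def)
    finally have 1: "f (g u) = exp (s * u)" .
    have "cosh (pi * u) = exp (pi * u) * (1 + E) / 2"
      by (simp add: cosh_def E_def distrib_left exp_add[symmetric])
    then have "cosh (pi * u) ^ 2 = (exp (pi * u) * (1 + E) / 2) ^ 2" by (simp only:)
    also have "\<dots> = exp (pi * u) ^ 2 * (1 + E) ^ 2 / 4"
      by (simp add: power_mult_distrib power_divide)
    also have "exp (pi * u) ^ 2 = 1 / E"
      by (simp add: E_def exp_double[symmetric] exp_minus field_simps)
    finally have "1 / cosh (pi * u) ^ 2 = 4 * E / (1 + E) ^ 2" using E by simp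
    then have "g' u = pi / 2 * (1 / cosh (pi * u) ^ 2)" by (simp add: g'_def E_def)
    with 1 show ?thesis by simp
  qed
  have prems: "(-\<infinity> :: ereal) < \<infinity>" "\<And>u. DERIV g u :> g' u" "\<And>u. isCont f (g u)" "\<And>u. isCont g' u"
      "\<And>u. 0 \<le> f (g u)" "\<And>u. 0 \<le> g' u"
      "((ereal \<circ> g \<circ> real_of_ereal) \<longlongrightarrow> 0) (at_right (- \<infinity>))"
      "((ereal \<circ> g \<circ> real_of_ereal) \<longlongrightarrow> 1) (at_left \<infinity>)"
      "set_integrable lborel (einterval (-\<infinity>) \<infinity>) (\<lambda>u. f (g u) * g' u)"
  proof -
    show "DERIV g u :> g' u" for u
      unfolding g_def g'_def using pos[of "- (2 * pi * u)"]
      by (auto intro!: derivative_eq_intros simp: power2_eq_square)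
    show "isCont f (g u)" for u
      unfolding f_def using g[of u] by (intro continuous_intros) auto
    show "isCont g' u" for u
      unfolding g'_def using pos[of "- (2 * pi * u)"] by (intro continuous_intros) auto
    show "0 \<le> f (g u)" for u by (simp add: f_def)
    show "0 \<le> g' u" for u by (simp add: g'_def)
    show "((ereal \<circ> g \<circ> real_of_ereal) \<longlongrightarrow> 0) (at_right (- \<infinity>))"
      unfolding ereal_tendsto_simps zero_ereal_def g_def by real_asymp
    show "((ereal \<circ> g \<circ> real_of_ereal) \<longlongrightarrow> 1) (at_left \<infinity>)"
      unfolding ereal_tendsto_simps one_ereal_def g_def by real_asymp
    show "set_integrable lborel (einterval (-\<infinity>) \<infinity>) (\<lambda>u. f (g u) * g' u)"
      unfolding fg using integrable_mult_right[OF integrable_exp_sech_square[of s], of "pi / 2"] s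
      by (simp add: set_integrable_def)
  qed simp
  note sub = interval_integral_substitution_nonneg[OF prems]
  have "(LBINT x=0..1. f x) = Beta (1 + a) (1 - a)"
  proof -
    have "((\<lambda>x. x powr ((1 + a) - 1) * (1 - x) powr ((1 - a) - 1)) has_integral Beta (1 + a) (1 - a)) {0..1}"
      using a by (intro has_integral_Beta_real) auto
    then have "(f has_integral Beta (1 + a) (1 - a)) {0..1}" by (simp add: f_def)
    then have "(f has_integral Beta (1 + a) (1 - a)) {0<..<1}"
      by (simp add: has_integral_Icc_iff_Ioo)
    moreover have "(LBINT x=0..1. f x) = integral {0<..<1} f"
      using set_borel_integral_eq_integral(2)[OF sub(1)]
      by (simp add: interval_lebesgue_integral_def zero_ereal_def one_ereal_def)
    ultimately show ?thesis by (simp add: integral_unique)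
  qed
  also have "\<dots> = pi * a / sin (pi * a)"
    using Gamma_real_reflection_shift[OF a] Gamma_fact[of 1, where 'a = real] by (simp add: Beta_def)
  finally have "pi * a / sin (pi * a) = (\<integral>u. pi / 2 * (exp (s * u) / cosh (pi * u) ^ 2) \<partial>lborel)"
    unfolding sub(2) fg by (simp add: interval_lebesgue_integral_def set_lebesgue_integral_def)
  also have "\<dots> = pi / 2 * (\<integral>u. exp (s * u) / cosh (pi * u) ^ 2 \<partial>lborel)"
    by (rule integral_mult_right_zero)
  finally have *: "s / sin (s / 2) = pi * (\<integral>u. exp (s * u) / cosh (pi * u) ^ 2 \<partial>lborel)"
    by (simp add: a_def mult_ac)
  have "(\<integral>u. exp (s * u) / cosh (pi * u) ^ 2 \<partial>lborel) = s / sin (s / 2) / pi"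
    unfolding * by simp
  then show ?thesis by (simp add: mult.commute)
qed

text \<open>This factorial bound gives the exponential generating function of the moments a radius
  of convergence of at least 1.\<close>

lemma sech_moment_le: "\<bar>sech_moment k 2\<bar> \<le> 4 * fact k"
proof -
  have "\<bar>sech_moment k 2\<bar> \<le> (\<integral>u. 2 * (\<bar>u\<bar> ^ k * exp (- \<bar>u\<bar>)) \<partial>lborel)"
  proof -
    have "\<bar>sech_moment k 2\<bar> \<le> (\<integral>u. norm (u ^ k / cosh (pi * u) ^ 2) \<partial>lborel)"
      unfolding sech_moment_def real_norm_def[symmetric] by (rule integral_norm_bound)
    also have "\<dots> \<le> (\<integral>u. 2 * (\<bar>u\<bar> ^ k * exp (- \<bar>u\<bar>)) \<partial>lborel)"
    proof (rule integral_mono)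
      show "integrable lborel (\<lambda>u::real. norm (u ^ k / cosh (pi * u) ^ 2))"
        by (intro integrable_norm integrable_power_sech) simp
      show "integrable lborel (\<lambda>u::real. 2 * (\<bar>u\<bar> ^ k * exp (- \<bar>u\<bar>)))"
        using has_bochner_integral_abs_power_exp[of k] by (auto simp: has_bochner_integral_iff)
      show "norm (u ^ k / cosh (pi * u) ^ 2) \<le> 2 * (\<bar>u\<bar> ^ k * exp (- \<bar>u\<bar>))" for u :: real
      proof -
        have "norm (u ^ k / cosh (pi * u) ^ 2) = \<bar>u\<bar> ^ k * (1 / cosh (pi * u) ^ 2)"
          by (simp add: abs_mult power_abs)
        also have "\<dots> \<le> \<bar>u\<bar> ^ k * (2 * exp (- \<bar>u\<bar>))"
          by (intro mult_left_mono inverse_cosh_power_le) auto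
        finally show ?thesis by simp
      qed
    qed
    finally show ?thesis .
  qed
  also have "\<dots> = 4 * fact k"
    using has_bochner_integral_abs_power_exp[of k] by (simp add: has_bochner_integral_iff)
  finally show ?thesis .
qed

text \<open>The exponential series is integrated termwise; the integrals of the absolute values are
  at most \<open>4 * s ^ k\<close>, which is summable for \<open>s < 1\<close>.\<close>

lemma sech_moment_sums:
  assumes s: "0 < s" "s < 1"
  shows "(\<lambda>k. sech_moment k 2 / fact k * s ^ k) sums (s / (pi * sin (s / 2)))"
proof -
  define f where "f = (\<lambda>k u::real. (s * u) ^ k / fact k / cosh (pi * u) ^ 2)"
  have f: "f k u = s ^ k / fact k * (u ^ k / cosh (pi * u) ^ 2)" for k u
    by (simp add: f_def power_mult_distrib)
  have nf: "norm (f k u) = s ^ k / fact k * norm (u ^ k / cosh (pi * u) ^ 2)" for k u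
    using s by (simp add: f abs_mult)
  have int: "integrable lborel (f k)" for k
    unfolding f by (intro integrable_mult_right integrable_power_sech) simp
  have exp_sums: "(\<lambda>k. f k u) sums (exp (s * u) / cosh (pi * u) ^ 2)" for u
    unfolding f_def using exp_converges[of "s * u"] by (intro sums_divide) (simp add: divide_inverse mult_ac)
  have "(\<lambda>k. integral\<^sup>L lborel (f k)) sums (\<integral>u. (\<Sum>k. f k u) \<partial>lborel)"
  proof (rule sums_integral[OF int])
    have "summable (\<lambda>k. norm (f k u))" for u
    proof -
      have "(\<lambda>k. norm (f k u)) = (\<lambda>k. inverse (fact k) * \<bar>s * u\<bar> ^ k / cosh (pi * u) ^ 2)"
        by (simp add: f_def power_abs divide_inverse mult_ac abs_mult)
      then show ?thesis using summable_exp[of "\<bar>s * u\<bar>"] by (simp add: summable_divide)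
    qed
    then show "AE u in lborel. summable (\<lambda>k. norm (f k u))" by simp
    show "summable (\<lambda>k. \<integral>u. norm (f k u) \<partial>lborel)"
    proof (rule summable_comparison_test)
      have "(\<integral>u. norm (f k u) \<partial>lborel) \<le> 4 * s ^ k" for k
      proof -
        have "(\<integral>u. norm (f k u) \<partial>lborel) \<le> (\<integral>u. s ^ k / fact k * (2 * (\<bar>u\<bar> ^ k * exp (- \<bar>u\<bar>))) \<partial>lborel)"
        proof (rule integral_mono)
          show "integrable lborel (\<lambda>u. norm (f k u))" using int by (rule integrable_norm)
          show "integrable lborel (\<lambda>u::real. s ^ k / fact k * (2 * (\<bar>u\<bar> ^ k * exp (- \<bar>u\<bar>))))"
            using has_bochner_integral_abs_power_exp[of k] by (auto simp: has_bochner_integral_iff)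
          show "norm (f k u) \<le> s ^ k / fact k * (2 * (\<bar>u\<bar> ^ k * exp (- \<bar>u\<bar>)))" for u
          proof -
            have "norm (u ^ k / cosh (pi * u) ^ 2) = \<bar>u\<bar> ^ k * (1 / cosh (pi * u) ^ 2)"
              by (simp add: abs_mult power_abs)
            also have "\<dots> \<le> \<bar>u\<bar> ^ k * (2 * exp (- \<bar>u\<bar>))"
              by (intro mult_left_mono inverse_cosh_power_le) auto
            also have "\<dots> = 2 * (\<bar>u\<bar> ^ k * exp (- \<bar>u\<bar>))" by simp
            finally show ?thesis unfolding nf using s by (intro mult_left_mono) auto
          qed
        qed
        also have "\<dots> = 4 * s ^ k"
          using has_bochner_integral_abs_power_exp[of k] by (simp add: has_bochner_integral_iff)
        finally show ?thesis .
      qed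
      then show "\<exists>N. \<forall>k\<ge>N. norm (\<integral>u. norm (f k u) \<partial>lborel) \<le> 4 * s ^ k"
        by (auto simp: abs_of_nonneg)
      show "summable (\<lambda>k. 4 * s ^ k)" using s by (intro summable_mult summable_geometric) auto
    qed
  qed
  also have "(\<lambda>k. integral\<^sup>L lborel (f k)) = (\<lambda>k. sech_moment k 2 / fact k * s ^ k)"
    unfolding f sech_moment_def by (subst integral_mult_right_zero) (simp add: mult_ac)
  also have "(\<lambda>u. \<Sum>k. f k u) = (\<lambda>u. exp (s * u) / cosh (pi * u) ^ 2)"
    using exp_sums by (simp add: sums_iff)
  also have "(\<integral>u. exp (s * u) / cosh (pi * u) ^ 2 \<partial>lborel) = s / (pi * sin (s / 2))"
    by (rule integral_exp_sech_square[OF s])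
  finally show ?thesis .
qed

definition sech_moment_fps :: "complex fps" where
  "sech_moment_fps = Abs_fps (\<lambda>k. of_real (sech_moment k 2 / fact k))"

text \<open>The closed form is available on the real interval from 0 to 1 only. Both sides are
  holomorphic on the unit disc and the interval accumulates at its centre, so the identity theorem
  applies. Clearing the sine from the denominator keeps both sides free of division.\<close>

lemma sech_moment_fps_mult_sin:
  "sech_moment_fps * fps_sin (1/2) = fps_const (1 / of_real pi) * fps_X"
proof (rule eval_fps_eqD)
  let ?G = sech_moment_fps
  have rad: "fps_conv_radius ?G \<ge> 1"
    unfolding fps_conv_radius_def
  proof (rule conv_radius_geI_ex)
    fix r :: real assume r: "0 < r" "ereal r < 1"
    have "summable (\<lambda>n. fps_nth ?G n * of_real r ^ n)"
    proof (rule summable_comparison_test)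
      have "norm (fps_nth ?G n * of_real r ^ n) \<le> 4 * r ^ n" for n
      proof -
        have "\<bar>sech_moment n 2\<bar> / fact n \<le> 4" using sech_moment_le[of n] by (simp add: field_simps)
        then have "\<bar>sech_moment n 2\<bar> / fact n * r ^ n \<le> 4 * r ^ n" using r by (intro mult_right_mono) auto
        then show ?thesis using r by (simp add: sech_moment_fps_def norm_mult norm_divide norm_power)
      qed
      then show "\<exists>N. \<forall>n\<ge>N. norm (fps_nth ?G n * of_real r ^ n) \<le> 4 * r ^ n" by blast
      show "summable (\<lambda>n. 4 * r ^ n)" using r by (intro summable_mult summable_geometric) auto
    qed
    then show "\<exists>z. norm z = r \<and> summable (\<lambda>n. fps_nth ?G n * z ^ n)"
      using r by (intro exI[of _ "of_real r"]) auto
  qed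
  have rad1: "fps_conv_radius (?G * fps_sin (1/2)) \<ge> 1"
    using fps_conv_radius_mult[of ?G "fps_sin (1/2)"] rad by (simp add: min_absorb1)
  then show "fps_conv_radius (?G * fps_sin (1/2)) > 0"
    by (rule less_le_trans[rotated]) simp
  have rad2: "fps_conv_radius (fps_const (1 / complex_of_real pi) * fps_X) = \<infinity>"
    using fps_conv_radius_mult[of "fps_const (1 / complex_of_real pi)" fps_X] by simp
  then show "fps_conv_radius (fps_const (1 / complex_of_real pi) * fps_X) > 0" by simp
  let ?D = "\<lambda>z. eval_fps (?G * fps_sin (1/2)) z - eval_fps (fps_const (1 / complex_of_real pi) * fps_X) z"
  have "?D z = 0" if "z \<in> ball 0 1" for z
  proof (rule analytic_continuation[of ?D "ball 0 1" "of_real ` {0<..<1}" 0])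
    have "ball 0 1 \<subseteq> eball (0::complex) (fps_conv_radius (?G * fps_sin (1/2)))"
    proof
      fix z :: complex assume "z \<in> ball 0 1"
      then have "ereal (norm z) < 1" by simp
      then show "z \<in> eball 0 (fps_conv_radius (?G * fps_sin (1/2)))"
        using less_le_trans[OF _ rad1] by (simp add: in_eball_iff)
    qed
    then show "?D holomorphic_on ball 0 1"
      by (intro holomorphic_intros) (auto simp: rad2)
    show "(of_real ` {0<..<1} :: complex set) \<subseteq> ball 0 1" by (auto simp: )
    show "0 islimpt (of_real ` {0<..<1} :: complex set)"
      unfolding islimpt_approachable
    proof (intro allI impI)
      fix e :: real assume "e > 0"
      define d where "d = min (e/2) (1/2)"
      have "d \<in> {0<..<1}" "d < e" using \<open>e > 0\<close> by (auto simp: d_def)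
      then show "\<exists>x'\<in>of_real ` {0<..<1}. x' \<noteq> 0 \<and> dist x' (0::complex) < e"
        by (intro bexI[of _ "of_real d"] conjI imageI) auto
    qed
    fix z :: complex assume "z \<in> of_real ` {0<..<1}"
    then obtain s where s: "0 < s" "s < 1" "z = of_real s" by auto
    have "eval_fps ?G z = of_real (s / (pi * sin (s / 2)))"
    proof -
      have "(\<lambda>k. complex_of_real (sech_moment k 2 / fact k * s ^ k)) sums of_real (s / (pi * sin (s / 2)))"
        using sech_moment_sums[OF s(1,2)] by (rule sums_of_real)
      then show ?thesis unfolding eval_fps_def sech_moment_fps_def s(3) by (simp add: sums_iff)
    qed
    moreover have "norm z < fps_conv_radius ?G"
      using rad s by (auto intro: less_le_trans[of _ 1])
    moreover have "sin (complex_of_real s / 2) \<noteq> 0"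
    proof -
      have "sin (s / 2) \<noteq> 0" using s sin_gt_zero[of "s / 2"] pi_ge_two by simp
      then have "complex_of_real (sin (s / 2)) \<noteq> 0" unfolding of_real_eq_0_iff .
      then show ?thesis
        unfolding sin_of_real[symmetric] by simp
    qed
    ultimately show "?D z = 0"
      by (simp add: eval_fps_mult s(3) sin_of_real[symmetric])
  qed (use that in auto)
  moreover have "\<forall>\<^sub>F z in nhds 0. z \<in> ball (0::complex) 1"
    by (intro eventually_nhds_in_open) auto
  ultimately show "\<forall>\<^sub>F z in nhds 0. eval_fps (?G * fps_sin (1/2)) z = eval_fps (fps_const (1 / complex_of_real pi) * fps_X) z"
    by (auto elim!: eventually_mono)
qed

text \<open>Putting \<open>s = \<i> x\<close> into \<open>s / (pi sin (s/2))\<close> gives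
  \<open>x / (pi sinh (x/2))\<close>, which is \<open>2 / pi\<close> times
  \<open>x exp (x/2) / (exp x - 1)\<close>. Formally this is composition with \<open>\<i> X\<close>
  followed by multiplication by \<open>fps_exp (1/2)\<close>.\<close>

lemma bernoulli_polynomial_half:
  "2 / of_real pi * bernoulli_polynomial k (1/2) = \<i> ^ k * of_real (sech_moment k 2)"
proof -
  let ?i = "fps_const \<i> * fps_X"
  define G where "G = sech_moment_fps oo ?i"
  define B where "B = fps_X * fps_exp (1/2) / (fps_exp 1 - 1 :: complex fps)"
  have half: "fps_exp (1/2) * fps_exp (1/2) = fps_exp (1::complex)" "fps_exp (-1/2) * fps_exp (1/2) = (1::complex fps)"
    by (simp_all add: fps_exp_add_mult[symmetric])
  have "fps_const (2*\<i>) * fps_sin (1/2) = fps_exp (\<i> * (1/2)) - fps_exp (- \<i> * (1/2))"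
    unfolding fps_sin_fps_exp_ii by (simp add: fps_divide_unit)
  then have "(fps_const (2*\<i>) * fps_sin (1/2)) oo ?i = (fps_exp (\<i> * (1/2)) - fps_exp (- \<i> * (1/2))) oo ?i"
    by simp
  also have "\<dots> = fps_exp (-1/2) - fps_exp (1/2)"
    by (simp add: fps_compose_sub_distrib)
  finally have sin: "(fps_const (2*\<i>) * fps_sin (1/2)) oo ?i = fps_exp (-1/2) - fps_exp (1/2)" .
  have "G * ((fps_const (2*\<i>) * fps_sin (1/2)) oo ?i) = (sech_moment_fps * (fps_const (2*\<i>) * fps_sin (1/2))) oo ?i"
    unfolding G_def by (subst fps_compose_mult_distrib) auto
  also have "sech_moment_fps * (fps_const (2*\<i>) * fps_sin (1/2)) = fps_const (2*\<i>) * (sech_moment_fps * fps_sin (1/2))"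
    by (simp only: mult_ac)
  also have "\<dots> = fps_const (2 * \<i> / of_real pi) * fps_X"
    unfolding sech_moment_fps_mult_sin by (simp add: mult.assoc[symmetric])
  also have "\<dots> oo ?i = fps_const (- 2 / of_real pi) * fps_X"
  proof -
    have "2 * \<i> / complex_of_real pi * \<i> = - 2 / of_real pi"
      by (subst times_divide_eq_left, subst mult.assoc) simp
    then show ?thesis
      by (simp add: fps_compose_mult_distrib mult.assoc[symmetric])
  qed
  finally have "G * (fps_exp (1/2) - fps_exp (-1/2)) = fps_const (2 / of_real pi) * fps_X"
    unfolding sin by (simp add: algebra_simps fps_const_neg[symmetric] minus_equation_iff[of "fps_const _ * _"] del: fps_const_neg)
  then have "G * (fps_exp (1/2) - fps_exp (-1/2)) * fps_exp (1/2) = fps_const (2 / of_real pi) * (fps_X * fps_exp (1/2))"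
    by (simp add: mult.assoc)
  also have "G * (fps_exp (1/2) - fps_exp (-1/2)) * fps_exp (1/2) = G * (fps_exp 1 - 1)"
    by (simp add: right_diff_distrib left_diff_distrib mult.assoc half half[simplified])
  \<comment> \<open>The division in \<open>B\<close> is exact: \<open>fps_exp 1 - 1\<close> has
    subdegree 1 and the numerator contains \<open>fps_X\<close>.\<close>
  also have "fps_X * fps_exp (1/2) = B * (fps_exp 1 - 1 :: complex fps)"
  proof -
    have ne: "fps_exp 1 - 1 \<noteq> (0 :: complex fps)"
      by (auto simp: fps_eq_iff intro!: exI[of _ 1])
    have "subdegree (fps_exp 1 - 1 :: complex fps) = 1"
      by (intro subdegreeI) auto
    then have "(fps_exp 1 - 1 :: complex fps) dvd fps_X * fps_exp (1/2)"
      using ne by (subst fps_dvd_iff) auto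
    then show ?thesis by (simp add: B_def)
  qed
  finally have "G * (fps_exp 1 - 1) = (fps_const (2 / of_real pi) * B) * (fps_exp 1 - 1)"
    by (simp add: mult.assoc)
  moreover have "fps_exp 1 - 1 \<noteq> (0 :: complex fps)"
    by (auto simp: fps_eq_iff intro!: exI[of _ 1])
  ultimately have "G = fps_const (2 / of_real pi) * B" by simp
  then have "fps_nth G k = 2 / of_real pi * fps_nth B k" by simp
  then have "\<i> ^ k * (of_real (sech_moment k 2) / fact k) = 2 / of_real pi * fps_nth B k"
    by (simp add: G_def sech_moment_fps_def)
  then show ?thesis
    unfolding bernoulli_polynomial_def B_def[symmetric] by (simp add: field_simps)
qed

lemma calE_even:
  "calE (int k) (2 * Suc j) = of_real (sech_moment k (2 * Suc j))"
proof (induction j arbitrary: k)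
  case 0
  have "calE (int k) 2 = \<i> powi (- int k) * (2 / of_real pi * bernoulli_polynomial k (1/2))"
    by (simp add: numeral_2_eq_2)
  also have "\<dots> = of_real (sech_moment k 2)"
    unfolding bernoulli_polynomial_half by (simp add: power_int_minus)
  finally show ?case by simp
next
  case (Suc j)
  define n where "n = Suc (2 * j)"
  have n: "2 * Suc (Suc j) = Suc (Suc (Suc n))" "2 * Suc j = Suc n" "Suc (Suc (Suc n)) = Suc n + 2"
    by (simp_all add: n_def)
  have rec: "sech_moment k (Suc n + 2) = real (Suc n) / real (Suc n + 1) * sech_moment k (Suc n) -
           real k * real (k - 1) / (pi ^ 2 * real (Suc n) * real (Suc n + 1)) * sech_moment (k - 2) (Suc n)"
    by (rule sech_moment_rec) simp
  have IH: "calE (int i) (Suc n) = of_real (sech_moment i (Suc n))" for i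
    using Suc.IH[of i] unfolding n(2) .
  have E: "calE (int k) (Suc (Suc (Suc n))) = of_nat (Suc n) / of_nat (Suc n + 1) * calE (int k) (Suc n)
        - of_int (int k * (int k - 1)) / (of_real pi ^ 2 * of_nat (Suc n) * of_nat (Suc n + 1)) * calE (int k - 2) (Suc n)"
    by (simp add: Let_def)
  \<comment> \<open>For \<open>k < 2\<close> the indices \<open>int k - 2\<close> and
    \<open>k - 2\<close> disagree, one being negative and the other truncated, but the factor
    \<open>k * (k - 1)\<close> is 0.\<close>
  have "of_int (int k * (int k - 1)) * calE (int k - 2) (Suc n) = of_real (real k * real (k - 1)) * of_real (sech_moment (k - 2) (Suc n))"
  proof (cases "k \<ge> 2")
    case True
    then have "int k - 2 = int (k - 2)" by simp
    then show ?thesis using True IH[of "k - 2"] by (simp add: of_nat_diff)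
  next
    case False
    then have "k = 0 \<or> k = 1" by auto
    then show ?thesis by auto
  qed
  then have A: "of_int (int k * (int k - 1)) / (of_real pi ^ 2 * of_nat (Suc n) * of_nat (Suc n + 1)) * calE (int k - 2) (Suc n)
      = of_real (real k * real (k - 1)) / (of_real pi ^ 2 * of_nat (Suc n) * of_nat (Suc n + 1)) * of_real (sech_moment (k - 2) (Suc n))"
    by (simp only: times_divide_eq_left)
  show ?case
    unfolding n(1) E IH A unfolding n(3) rec by simp
qed

section \<open>The asymptotic expansion\<close>

lemma continuous_on_theta_corr [continuous_intros]:
  assumes k: "0 < k" "k < 1" and f: "continuous_on S f" and pos: "\<And>x. x \<in> S \<Longrightarrow> f x > 0"
  shows "continuous_on S (\<lambda>x. theta_corr k (f x))"
proof -
  have p: "0 < k^2" "k^2 < 1" using k by (auto simp: power_less_one_iff)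
  have f0: "f x \<noteq> 0" if "x \<in> S" for x using pos[OF that] by simp
  have "qpoch_real (k^2) (- z) \<noteq> 0" if "z > 0" for z
    using qpoch_real_pos[OF p, of "- z"] that by simp
  then have "qpoch_real (k^2) (- (k^2 * f x)) * qpoch_real (k^2) (- (k^2 / f x)) \<noteq> 0" if "x \<in> S" for x
    using k pos[OF that] by simp
  moreover have qc: "continuous_on S (\<lambda>x. qpoch_real (k^2) (g x))" if "continuous_on S g" for g
    unfolding qpoch_real_def by (intro continuous_intros p that)
  ultimately show ?thesis
    unfolding theta_corr_def using f f0 by (intro continuous_intros qc) auto
qed

text \<open>The Fourier integrand after \<open>x = t * u\<close>, stripped of its growing prefactor
  and multiplied by the dual eta product. The indicator carries the range of \<open>x\<close>, so
  that the domain of integration no longer depends on \<open>t\<close>.\<close>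

definition scaled_integrand :: "nat \<Rightarrow> int \<Rightarrow> real \<Rightarrow> real \<Rightarrow> complex" where
  "scaled_integrand m r t u = indicator {-1/2..1/2} (t * u) *\<^sub>R
     (of_real (qpoch_real (exp (-2 * pi / t)) (exp (-2 * pi / t)) *
               theta_corr (exp (- pi / t)) (exp (2 * pi * u)) ^ m / cosh (pi * u) ^ m) *
      exp (\<i> * of_real (- 2 * pi * of_int r * t * u)))"

text \<open>The theta quotients contribute \<open>exp (pi * m / (4 * t)) / 2 ^ m\<close>, the eta
  transformation \<open>exp (pi * t / 12 - pi / (12 * t)) / sqrt t\<close>, and the substitution
  \<open>t\<close>; together they form the prefactor.\<close>

lemma trL0_eq_scaled_integral:
  assumes t: "t > 0"
  shows "integrable lborel (scaled_integrand m r t)"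
    and "trL0 m r (\<i> * of_real t) =
           of_real (exp (pi * t / 12 + pi / (12 * t) * (3 * real m - 1)) * sqrt t / 2 ^ m) *
           (\<integral>u. scaled_integrand m r t u \<partial>lborel)"
proof -
  define k where "k = exp (- pi / t)"
  define p where "p = exp (-2 * pi / t)"
  have k: "0 < k" "k < 1" using t by (auto simp: k_def)
  define g where "g = (\<lambda>x. of_real ((exp (pi / (4 * t)) / (2 * cosh (pi * x / t)) *
                    theta_corr k (exp (2 * pi * x / t))) ^ m) *
               exp (- (2 * of_real pi * \<i> * of_int r * of_real x)))"
  define c where "c = exp (pi / (4 * t)) ^ m / 2 ^ m"
  have c: "c > 0" by (simp add: c_def)
  define P where "P = qpoch_real p p"
  have P: "P > 0" unfolding P_def using t by (intro qpoch_real_pos) (auto simp: p_def)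
  have "continuous_on {-1/2..1/2} g"
    unfolding g_def using k t by (intro continuous_intros) auto
  then have gi: "set_integrable lborel {-1/2..1/2} g"
    by (rule borel_integrable_atLeastAtMost')
  \<comment> \<open>The form \<open>0 + t * u\<close> matches the affine change of variables for the
    Lebesgue measure.\<close>
  have si: "scaled_integrand m r t u = of_real (P / c) * (indicator {-1/2..1/2} (0 + t * u) *\<^sub>R g (0 + t * u))" for u
  proof -
    have "g (t * u) = of_real (c * theta_corr k (exp (2 * pi * u)) ^ m / cosh (pi * u) ^ m) * exp (\<i> * of_real (- 2 * pi * of_int r * t * u))"
      unfolding g_def c_def using t by (simp add: power_mult_distrib power_divide mult_ac)
    then show ?thesis
      unfolding scaled_integrand_def P_def p_def k_def using c by (simp add: k_def)
  qed
  have "integrable lborel (\<lambda>u. indicator {-1/2..1/2} (0 + t * u) *\<^sub>R g (0 + t * u))"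
    using gi t unfolding set_integrable_def by (intro lborel_integrable_real_affine) auto
  then show "integrable lborel (scaled_integrand m r t)"
    unfolding si[abs_def] by (rule integrable_mult_right)
  have "chF m r (\<i> * of_real t) = integral {-1/2..1/2} g"
    using chF_has_integral[OF t, of m r] unfolding g_def k_def by (simp add: integral_unique)
  also have "\<dots> = (LINT x:{-1/2..1/2}|lborel. g x)"
    using set_borel_integral_eq_integral(2)[OF gi] by simp
  also have "\<dots> = t *\<^sub>R (\<integral>u. indicator {-1/2..1/2} (0 + t * u) *\<^sub>R g (0 + t * u) \<partial>lborel)"
    unfolding set_lebesgue_integral_def using t by (subst lborel_integral_real_affine[of t _ 0]) auto
  finally have chF: "chF m r (\<i> * of_real t) = of_real t * (\<integral>u. indicator {-1/2..1/2} (0 + t * u) *\<^sub>R g (0 + t * u) \<partial>lborel)"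
    by (simp add: scaleR_conv_of_real)
  have int: "(\<integral>u. scaled_integrand m r t u \<partial>lborel) = of_real (P / c) * (\<integral>u. indicator {-1/2..1/2} (0 + t * u) *\<^sub>R g (0 + t * u) \<partial>lborel)"
    unfolding si by (rule integral_mult_right_zero)
  have "trL0 m r (\<i> * of_real t) = chF m r (\<i> * of_real t) * of_real (exp (pi * t / 12 - pi / (12 * t)) / sqrt t * P)"
    unfolding trL0_def prod_imaginary[OF t] eta_modular[OF t] P_def p_def ..
  also have "\<dots> = of_real (t * exp (pi * t / 12 - pi / (12 * t)) / sqrt t * c) * (\<integral>u. scaled_integrand m r t u \<partial>lborel)"
    unfolding int chF using c by simp
  also have "t * exp (pi * t / 12 - pi / (12 * t)) / sqrt t * c = exp (pi * t / 12 + pi / (12 * t) * (3 * real m - 1)) * sqrt t / 2 ^ m"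
  proof -
    have "t / sqrt t = sqrt t" using t by (simp add: real_div_sqrt)
    moreover have "exp (pi * t / 12 - pi / (12 * t)) * exp (pi / (4 * t)) ^ m = exp (pi * t / 12 + pi / (12 * t) * (3 * real m - 1))"
      unfolding exp_of_nat_mult[symmetric] exp_add[symmetric] using t by (simp add: field_simps)
    moreover have "t * exp (pi * t / 12 - pi / (12 * t)) / sqrt t * c = (t / sqrt t) * (exp (pi * t / 12 - pi / (12 * t)) * exp (pi / (4 * t)) ^ m) / 2 ^ m"
      by (simp add: c_def)
    ultimately show ?thesis by simp
  qed
  finally show "trL0 m r (\<i> * of_real t) =
           of_real (exp (pi * t / 12 + pi / (12 * t) * (3 * real m - 1)) * sqrt t / 2 ^ m) *
           (\<integral>u. scaled_integrand m r t u \<partial>lborel)" .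
qed

section \<open>Error estimates uniform in \<open>t\<close>\<close>

lemma qpoch_real_self_bounds:
  assumes p: "0 < p" "p \<le> 1/2"
  shows "exp (- (4 * p)) \<le> qpoch_real p p" "qpoch_real p p \<le> 1"
proof -
  have hp: "(\<lambda>k. 1 - p * p ^ k) has_prod qpoch_real p p"
    using p by (intro qpoch_real_has_prod) auto
  have le: "p * p ^ k \<le> 1/2" for k
  proof -
    have "p * p ^ k \<le> p * 1" using p by (intro mult_left_mono power_le_one) auto
    then show ?thesis using p by linarith
  qed
  show "qpoch_real p p \<le> 1"
    by (rule has_prod_le[OF hp has_prod_one]) (use p le in \<open>auto intro: order.trans[OF le]\<close>)
  \<comment> \<open>The factor 2 here and \<open>1 / (1 - p) \<le> 2\<close> below combine to the
    exponent \<open>4 * p\<close>.\<close>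
  have "exp (- (2 * x)) \<le> 1 - x" if "0 \<le> x" "x \<le> 1/2" for x :: real
  proof -
    have "x * x \<le> x * (1/2)" using that by (intro mult_left_mono) auto
    then have "- (2 * x) \<le> - x - 2 * x^2" by (simp add: power2_eq_square)
    also have "\<dots> \<le> ln (1 - x)" using that by (intro ln_one_minus_pos_lower_bound) auto
    finally show ?thesis using that by (subst (asm) ln_ge_iff) auto
  qed
  then have *: "exp (- (2 * (p * p ^ k))) \<le> 1 - p * p ^ k" for k
    using p le[of k] by simp
  have "(\<lambda>k. - (2 * (p * p ^ k))) sums (- (2 * (p * (1 / (1 - p)))))"
    using p by (intro sums_minus sums_mult geometric_sums) auto
  then have e: "(\<lambda>k. exp (- (2 * (p * p ^ k)))) has_prod exp (- (2 * (p * (1 / (1 - p)))))"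
    using sums_imp_has_prod_exp by (auto simp: has_prod_def)
  have "p * (1 / (1 - p)) \<le> p * 2"
    using p by (intro mult_left_mono) (auto simp: field_simps)
  then have "exp (- (4 * p)) \<le> exp (- (2 * (p * (1 / (1 - p)))))" by simp
  also have "\<dots> \<le> qpoch_real p p"
    by (rule has_prod_le[OF e hp]) (use * in auto)
  finally show "exp (- (4 * p)) \<le> qpoch_real p p" .
qed

lemma power_le_fact_exp:
  fixes x :: real
  assumes "x \<ge> 0"
  shows "x ^ n \<le> fact n * exp x"
proof -
  have "inverse (fact n) * x ^ n \<le> exp x"
    using sum_le_suminf[OF summable_exp[of x], of "{n}"] assms exp_converges[of x]
    by (simp add: sums_iff divide_inverse mult_ac)
  then show ?thesis by (simp add: field_simps)
qed

text \<open>Only the weighted error is small, since near \<open>\<bar>u\<bar> = 1 / (2 * t)\<close>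
  the correction itself stays away from 1. The deviation is controlled by
  \<open>k * (y + 1 / y)\<close>, and \<open>y + 1 / y = 2 * cosh (2 * pi * u) \<le> 4 * cosh (pi *
  u) ^ 2\<close> is absorbed by the weight because \<open>m \<ge> 2\<close>; the factor
  \<open>k\<close> is left.\<close>

lemma theta_corr_error:
  assumes t: "0 < t" "t \<le> 1" and m: "m \<ge> 2" and u: "\<bar>t * u\<bar> \<le> 1/2"
  shows "\<bar>qpoch_real (exp (-2 * pi / t)) (exp (-2 * pi / t)) * theta_corr (exp (- pi / t)) (exp (2 * pi * u)) ^ m - 1\<bar>
           / cosh (pi * u) ^ m \<le> 8 * real (m + 1) * exp (4 * real (m + 1)) * exp (- pi / t)"
proof -
  define k where "k = exp (- pi / t)"
  define y where "y = exp (2 * pi * u)"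
  have pk: "exp (-2 * pi / t) = k^2" by (simp add: k_def exp_double[symmetric])
  have k0: "k > 0" and y: "y > 0" by (auto simp: k_def y_def)
  have khalf: "k \<le> 1/2"
  proof -
    have "pi / t \<ge> 2 / 1" using t pi_ge_two by (intro frac_le) auto
    then have "2 \<le> exp (pi / t)" using exp_ge_add_one_self[of "pi / t"] by linarith
    then show ?thesis by (simp add: k_def exp_minus field_simps)
  qed
  have k2: "k^2 \<le> k" "k^2 \<le> 1/2" using khalf k0 by (auto simp: power2_eq_square intro: mult_left_le order.trans[of _ k])
  \<comment> \<open>The exponent from \<open>theta_corr_bounds\<close>. The range of
    \<open>u\<close> keeps \<open>y\<close> and \<open>1 / y\<close> below \<open>1 / k\<close>,
    hence \<open>a \<le> 4\<close>; this is the origin of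
    \<open>exp (4 * real (m + 1))\<close>.\<close>
  define a where "a = 2 * k * (y + 1 / y)"
  have yb: "y \<le> 1 / k" "1 / y \<le> 1 / k"
  proof -
    have "\<bar>u\<bar> \<le> 1 / (2 * t)" using u t by (simp add: abs_mult field_simps)
    then have "2 * pi * \<bar>u\<bar> \<le> 2 * pi * (1 / (2 * t))" by (intro mult_left_mono) auto
    then have "2 * pi * \<bar>u\<bar> \<le> pi / t" by simp
    moreover have "\<bar>2 * pi * u\<bar> = 2 * pi * \<bar>u\<bar>" by (simp add: abs_mult)
    ultimately have "2 * pi * u \<le> pi / t" "- (2 * pi * u) \<le> pi / t" by linarith+
    then have "exp (2 * pi * u) \<le> exp (pi / t)" "exp (- (2 * pi * u)) \<le> exp (pi / t)" by simp_all
    then show "y \<le> 1 / k" "1 / y \<le> 1 / k" by (simp_all add: y_def k_def exp_minus inverse_eq_divide)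
  qed
  have y2: "y + 1 / y \<ge> 2"
  proof -
    have "0 \<le> (y - 1) ^ 2 / y" using y by simp
    also have "(y - 1) ^ 2 / y = y + 1 / y - 2" using y by (simp add: power2_eq_square field_simps)
    finally show ?thesis by simp
  qed
  have a0: "a \<ge> 0" using k0 y by (simp add: a_def)
  have a4: "a \<le> 4"
  proof -
    have "2 * k * (y + 1 / y) \<le> 2 * k * (1 / k + 1 / k)" using yb k0 by (intro mult_left_mono add_mono) auto
    then show ?thesis using k0 by (simp add: a_def)
  qed
  define P where "P = qpoch_real (k^2) (k^2)"
  define \<rho> where "\<rho> = theta_corr k y"
  have P: "exp (- a) \<le> P" "P \<le> 1"
  proof -
    have "4 * k^2 \<le> 2 * k * 2" using k2 by simp
    also have "\<dots> \<le> a" unfolding a_def using y2 k0 by (intro mult_left_mono) auto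
    finally have "exp (- a) \<le> exp (- (4 * k^2))" by simp
    also have "\<dots> \<le> P" unfolding P_def using k0 k2 by (intro qpoch_real_self_bounds) auto
    finally show "exp (- a) \<le> P" .
    show "P \<le> 1" unfolding P_def using k0 k2 by (intro qpoch_real_self_bounds) auto
  qed
  have \<rho>: "exp (- a) \<le> \<rho>" "\<rho> \<le> exp a"
    unfolding \<rho>_def a_def using theta_corr_bounds[OF k0 k2(2) y] by auto
  have pos: "0 \<le> P" "0 \<le> \<rho>"
    using P(1) \<rho>(1) exp_gt_zero[of "- a"] by linarith+
  \<comment> \<open>One copy of \<open>a\<close> for each of the \<open>m\<close> factors
    \<open>\<rho>\<close>, and one more for \<open>P\<close>, whose own exponent
    \<open>4 * k^2\<close> is at most \<open>a\<close>.\<close>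
  define b where "b = real (m + 1) * a"
  have b: "0 \<le> b" "b \<le> 4 * real (m + 1)" using a0 mult_left_mono[OF a4, of "real (m + 1)"] by (auto simp: b_def)
  have "exp (- a) * exp (- a) ^ m \<le> P * \<rho> ^ m"
    using P \<rho> pos by (intro mult_mono power_mono) auto
  then have lower: "exp (- b) \<le> P * \<rho> ^ m"
    by (simp add: b_def exp_of_nat_mult[symmetric] exp_add[symmetric] algebra_simps)
  have "P * \<rho> ^ m \<le> 1 * exp a ^ m"
    using P \<rho> pos by (intro mult_mono power_mono) auto
  also have "\<dots> \<le> exp b"
    using a0 by (simp add: b_def exp_of_nat_mult[symmetric] algebra_simps)
  finally have upper: "P * \<rho> ^ m \<le> exp b" .
  have "\<bar>P * \<rho> ^ m - 1\<bar> \<le> b * exp b"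
  proof -
    have "1 - b \<le> exp (- b)" using exp_ge_add_one_self[of "- b"] by simp
    moreover have "b \<le> b * exp b" using b by (simp add: mult_le_cancel_left1)
    moreover have "exp b * (1 - b) \<le> exp b * exp (- b)"
      using \<open>1 - b \<le> exp (- b)\<close> by (intro mult_left_mono) auto
    then have "exp b - 1 \<le> b * exp b" by (simp add: exp_minus algebra_simps)
    ultimately show ?thesis using lower upper by linarith
  qed
  also have "\<dots> \<le> b * exp (4 * real (m + 1))" using b by (intro mult_left_mono) auto
  also have "\<dots> = real (m + 1) * exp (4 * real (m + 1)) * 2 * k * (y + 1 / y)"
    by (simp add: b_def a_def)
  finally have main: "\<bar>P * \<rho> ^ m - 1\<bar> \<le> real (m + 1) * exp (4 * real (m + 1)) * 2 * k * (y + 1 / y)" .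
  have "y + 1 / y = 2 * cosh (2 * (pi * u))"
    by (simp add: y_def cosh_def exp_minus field_simps)
  also have "\<dots> \<le> 4 * cosh (pi * u) ^ 2"
    by (simp add: cosh_double_cosh)
  also have "\<dots> \<le> 4 * cosh (pi * u) ^ m"
    by (intro mult_left_mono power_increasing m cosh_real_ge_1) auto
  finally have yc: "y + 1 / y \<le> 4 * cosh (pi * u) ^ m" .
  note main
  also have "real (m + 1) * exp (4 * real (m + 1)) * 2 * k * (y + 1 / y) \<le>
      real (m + 1) * exp (4 * real (m + 1)) * 2 * k * (4 * cosh (pi * u) ^ m)"
    using yc k0 by (intro mult_left_mono) auto
  also have "\<dots> = (8 * real (m + 1) * exp (4 * real (m + 1)) * k) * cosh (pi * u) ^ m"
    by simp
  finally have "\<bar>P * \<rho> ^ m - 1\<bar> \<le> (8 * real (m + 1) * exp (4 * real (m + 1)) * k) * cosh (pi * u) ^ m" .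
  then have "\<bar>P * \<rho> ^ m - 1\<bar> / cosh (pi * u) ^ m \<le> 8 * real (m + 1) * exp (4 * real (m + 1)) * k"
    by (subst pos_divide_le_eq) auto
  then show ?thesis unfolding pk unfolding P_def \<rho>_def k_def y_def .
qed


text \<open>The model integrand: no cutoff, no correction, and the exponential replaced by its
  Taylor polynomial, so that its integral is a finite combination of moments.\<close>

definition scaled_limit :: "nat \<Rightarrow> int \<Rightarrow> nat \<Rightarrow> real \<Rightarrow> real \<Rightarrow> complex" where
  "scaled_limit m r N t u = of_real (1 / cosh (pi * u) ^ m) *
     (\<Sum>k\<le>N. (\<i> * of_real (- 2 * pi * of_int r * t * u)) ^ k / fact k)"

lemma scaled_limit_integral:
  assumes m: "m \<ge> 1"
  shows "integrable lborel (scaled_limit m r N t)"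
    and "(\<integral>u. scaled_limit m r N t u \<partial>lborel) =
           (\<Sum>k\<le>N. (- 2 * of_real pi * \<i> * of_int r) ^ k * of_real (sech_moment k m) * of_real (t ^ k / fact k))"
proof -
  define C where "C = (\<lambda>k. (- 2 * of_real pi * \<i> * of_int r) ^ k * complex_of_real (t ^ k / fact k))"
  have eq: "scaled_limit m r N t u = (\<Sum>k\<le>N. C k * of_real (u ^ k / cosh (pi * u) ^ m))" for u
    unfolding scaled_limit_def C_def sum_distrib_left
    by (intro sum.cong refl) (simp add: power_mult_distrib power_minus[of "_ * _"] mult_ac)
  have int: "integrable lborel (\<lambda>u. C k * complex_of_real (u ^ k / cosh (pi * u) ^ m))" for k
    using integrable_power_sech[OF m, of k] by (intro integrable_mult_right integrable_of_real)
  show "integrable lborel (scaled_limit m r N t)"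
    unfolding eq[abs_def] by (intro Bochner_Integration.integrable_sum int)
  have "(\<integral>u. scaled_limit m r N t u \<partial>lborel) = (\<Sum>k\<le>N. \<integral>u. C k * complex_of_real (u ^ k / cosh (pi * u) ^ m) \<partial>lborel)"
    unfolding eq by (intro Bochner_Integration.integral_sum int)
  also have "\<dots> = (\<Sum>k\<le>N. C k * of_real (sech_moment k m))"
    unfolding sech_moment_def integral_mult_right_zero integral_complex_of_real ..
  also have "\<dots> = (\<Sum>k\<le>N. (- 2 * of_real pi * \<i> * of_int r) ^ k * of_real (sech_moment k m) * of_real (t ^ k / fact k))"
    unfolding C_def by (intro sum.cong refl) (simp only: mult_ac)
  finally show "(\<integral>u. scaled_limit m r N t u \<partial>lborel) =
           (\<Sum>k\<le>N. (- 2 * of_real pi * \<i> * of_int r) ^ k * of_real (sech_moment k m) * of_real (t ^ k / fact k))" .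
qed

text \<open>The error \<open>exp (- pi / t)\<close> is spent in two equal halves: this one pays for
  the power of \<open>t\<close>, the other for the decay in \<open>u\<close>.\<close>

lemma exp_neg_le_power:
  assumes "0 < t"
  shows "exp (- pi / (2 * t)) \<le> fact n * t ^ n"
proof -
  have "(1 / t) ^ n \<le> fact n * exp (1 / t)"
    using assms by (intro power_le_fact_exp) auto
  also have "\<dots> \<le> fact n * exp (pi / (2 * t))"
    using assms pi_ge_two by (intro mult_left_mono) (auto simp: field_simps)
  finally have "1 / t ^ n \<le> fact n * exp (pi / (2 * t))" by (simp add: power_divide)
  then have "1 \<le> fact n * exp (pi / (2 * t)) * t ^ n" using assms by (simp add: field_simps)
  then have "exp (- pi / (2 * t)) * 1 \<le> exp (- pi / (2 * t)) * (fact n * exp (pi / (2 * t)) * t ^ n)"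
    by (intro mult_left_mono) auto
  also have "\<dots> = fact n * t ^ n" by (simp add: exp_minus field_simps)
  finally show ?thesis by simp
qed

text \<open>The bound separates \<open>t ^ (N + 1)\<close> from an integrable function of
  \<open>u\<close>. \<open>C1\<close> accounts for the correction factor. In \<open>C2\<close> the
  first term is the Taylor remainder inside the cutoff, the second bounds the Taylor polynomial
  outside it, where the integrand is 0.\<close>

lemma scaled_integrand_error:
  fixes r :: int and m N :: nat
  assumes m: "m \<ge> 2"
  defines "C1 \<equiv> 8 * real (m + 1) * exp (4 * real (m + 1)) * fact (N + 1)"
    and "C2 \<equiv> 2 * ((2 * pi * \<bar>r\<bar>) ^ (N + 1) + 2 ^ (N + 1) * (\<Sum>k\<le>N. (2 * pi * \<bar>r\<bar>) ^ k))"
  assumes t: "0 < t" "t \<le> 1"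
  shows "norm (scaled_integrand m r t u - scaled_limit m r N t u) \<le>
           t ^ (N + 1) * (C1 * exp (- \<bar>u\<bar>) + C2 * (\<bar>u\<bar> ^ (N + 1) * exp (- \<bar>u\<bar>)))"
proof -
  define w where "w = - 2 * pi * of_int r * t * u"
  define S where "S = 1 / cosh (pi * u) ^ m"
  define c where "c = 2 * pi * \<bar>real_of_int r\<bar>"
  have c: "c \<ge> 0" by (simp add: c_def)
  have absw: "\<bar>w\<bar> = c * (t * \<bar>u\<bar>)" using t by (simp add: w_def c_def abs_mult)
  have S: "0 \<le> S" "S \<le> 2 * exp (- \<bar>u\<bar>)"
    using inverse_cosh_power_le[of m u] m by (auto simp: S_def)
  have C1: "C1 \<ge> 0" unfolding C1_def by simp
  have C2: "C2 = 2 * (c ^ (N + 1) + 2 ^ (N + 1) * (\<Sum>k\<le>N. c ^ k))" by (simp add: C2_def c_def)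
  have sum0: "(\<Sum>k\<le>N. c ^ k) \<ge> 0" using c by (intro sum_nonneg) auto
  define T where "T = (\<Sum>k\<le>N. (\<i> * complex_of_real w) ^ k / fact k)"
  have lim: "scaled_limit m r N t u = of_real S * T"
    by (simp add: scaled_limit_def S_def T_def w_def)
  show ?thesis
  proof (cases "\<bar>t * u\<bar> \<le> 1/2")
    case True
    define Q where "Q = qpoch_real (exp (-2 * pi / t)) (exp (-2 * pi / t)) *
               theta_corr (exp (- pi / t)) (exp (2 * pi * u)) ^ m"
    have "t * u \<in> {-1/2..1/2}" using True by (auto simp: abs_le_iff)
    then have "scaled_integrand m r t u = of_real (Q * S) * iexp w"
      by (simp add: scaled_integrand_def Q_def S_def w_def)
    then have "scaled_integrand m r t u - scaled_limit m r N t u = of_real ((Q - 1) * S) * iexp w + of_real S * (iexp w - T)"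
      unfolding lim by (simp add: algebra_simps)
    then have "norm (scaled_integrand m r t u - scaled_limit m r N t u) \<le> \<bar>(Q - 1) * S\<bar> + S * norm (iexp w - T)"
      using S(1) by (metis (no_types, lifting) abs_of_nonneg norm_exp_i_times norm_mult norm_of_real norm_triangle_ineq mult.right_neutral)
    also have "\<bar>(Q - 1) * S\<bar> \<le> t ^ (N + 1) * (C1 * exp (- \<bar>u\<bar>))"
    proof -
      have "\<bar>(Q - 1) * S\<bar> = \<bar>Q - 1\<bar> / cosh (pi * u) ^ m"
        by (simp add: S_def abs_mult)
      also have "\<dots> \<le> 8 * real (m + 1) * exp (4 * real (m + 1)) * exp (- pi / t)"
        unfolding Q_def by (rule theta_corr_error[OF t m True])
      also have "exp (- pi / t) \<le> fact (N + 1) * t ^ (N + 1) * exp (- \<bar>u\<bar>)"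
      proof -
        have "t * \<bar>u\<bar> \<le> 1/2" using True t by (simp add: abs_mult)
        then have "\<bar>u\<bar> \<le> 1 / (2 * t)" using t by (simp add: field_simps)
        also have "\<dots> \<le> pi / (2 * t)" using t pi_ge_two by (intro divide_right_mono) auto
        finally have "exp (- pi / (2 * t)) \<le> exp (- \<bar>u\<bar>)" by simp
        moreover have "exp (- pi / t) = exp (- pi / (2 * t)) * exp (- pi / (2 * t))"
          by (simp add: exp_add[symmetric])
        ultimately show ?thesis
          using exp_neg_le_power[OF t(1), of "N + 1"] t by (auto intro!: mult_mono)
      qed
      finally show ?thesis by (simp add: C1_def mult_ac mult_left_mono)
    qed
    also have "S * norm (iexp w - T) \<le> t ^ (N + 1) * (C2 * (\<bar>u\<bar> ^ (N + 1) * exp (- \<bar>u\<bar>)))"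
    proof -
      have "norm (iexp w - T) \<le> \<bar>w\<bar> ^ (N + 1) / fact (N + 1)"
        unfolding T_def using iexp_approx1[of w N] by simp
      also have "\<dots> \<le> \<bar>w\<bar> ^ (N + 1) / 1"
        by (intro divide_left_mono fact_ge_1) auto
      finally have "norm (iexp w - T) \<le> \<bar>w\<bar> ^ (N + 1)" by simp
      then have "S * norm (iexp w - T) \<le> 2 * exp (- \<bar>u\<bar>) * \<bar>w\<bar> ^ (N + 1)"
        using S by (intro mult_mono) auto
      also have "\<bar>w\<bar> ^ (N + 1) = c ^ (N + 1) * t ^ (N + 1) * \<bar>u\<bar> ^ (N + 1)"
        unfolding absw power_mult_distrib by (simp only: mult_ac)
      also have "2 * exp (- \<bar>u\<bar>) * (c ^ (N + 1) * t ^ (N + 1) * \<bar>u\<bar> ^ (N + 1)) =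
          (2 * c ^ (N + 1)) * (t ^ (N + 1) * (\<bar>u\<bar> ^ (N + 1) * exp (- \<bar>u\<bar>)))"
        by (simp only: mult_ac)
      also have "\<dots> \<le> C2 * (t ^ (N + 1) * (\<bar>u\<bar> ^ (N + 1) * exp (- \<bar>u\<bar>)))"
        unfolding C2 using sum0 t by (intro mult_right_mono) auto
      finally show ?thesis by (simp only: mult_ac)
    qed
    finally show ?thesis by (simp add: distrib_left)
  next
    case False
    then have "scaled_integrand m r t u = 0"
      by (auto simp: scaled_integrand_def indicator_def abs_le_iff)
    then have "norm (scaled_integrand m r t u - scaled_limit m r N t u) = S * norm T"
      unfolding lim using S by (simp add: norm_mult)
    also have "norm T \<le> (\<Sum>k\<le>N. c ^ k) * (2 * (t * \<bar>u\<bar>)) ^ (N + 1)"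
      unfolding T_def sum_distrib_right
    proof (rule sum_norm_le)
      fix k assume "k \<in> {..N}"
      then have k: "k \<le> N + 1" by simp
      \<comment> \<open>Outside the cutoff every power up to \<open>N\<close> of
        \<open>2 * (t * \<bar>u\<bar>)\<close> may be raised to \<open>N + 1\<close>; hence the
        factor \<open>2 ^ (N + 1)\<close> in \<open>C2\<close>.\<close>
      have tu: "1 \<le> 2 * (t * \<bar>u\<bar>)" using False t by (simp add: abs_mult)
      have "norm ((\<i> * complex_of_real w) ^ k / fact k) = \<bar>w\<bar> ^ k / fact k"
        by (simp add: norm_divide norm_power norm_mult)
      also have "\<dots> \<le> \<bar>w\<bar> ^ k / 1" by (intro divide_left_mono fact_ge_1) auto
      also have "\<dots> = c ^ k * (t * \<bar>u\<bar>) ^ k" by (simp add: absw power_mult_distrib)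
      also have "\<dots> \<le> c ^ k * (2 * (t * \<bar>u\<bar>)) ^ k"
        using c t by (intro mult_left_mono power_mono) auto
      also have "\<dots> \<le> c ^ k * (2 * (t * \<bar>u\<bar>)) ^ (N + 1)"
        using c by (intro mult_left_mono power_increasing tu k) auto
      finally show "norm ((\<i> * complex_of_real w) ^ k / fact k) \<le> c ^ k * (2 * (t * \<bar>u\<bar>)) ^ (N + 1)" .
    qed
    then have "S * norm T \<le> 2 * exp (- \<bar>u\<bar>) * ((\<Sum>k\<le>N. c ^ k) * (2 * (t * \<bar>u\<bar>)) ^ (N + 1))"
      using S by (intro mult_mono) auto
    also have "(2 * (t * \<bar>u\<bar>)) ^ (N + 1) = 2 ^ (N + 1) * (t ^ (N + 1) * \<bar>u\<bar> ^ (N + 1))"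
      by (simp only: power_mult_distrib)
    also have "2 * exp (- \<bar>u\<bar>) * ((\<Sum>k\<le>N. c ^ k) * (2 ^ (N + 1) * (t ^ (N + 1) * \<bar>u\<bar> ^ (N + 1)))) =
        (2 * (2 ^ (N + 1) * (\<Sum>k\<le>N. c ^ k))) * (t ^ (N + 1) * (\<bar>u\<bar> ^ (N + 1) * exp (- \<bar>u\<bar>)))"
      by (simp only: mult_ac)
    also have "\<dots> \<le> C2 * (t ^ (N + 1) * (\<bar>u\<bar> ^ (N + 1) * exp (- \<bar>u\<bar>)))"
      unfolding C2 using c t by (intro mult_right_mono) auto
    also have "\<dots> = t ^ (N + 1) * (0 + C2 * (\<bar>u\<bar> ^ (N + 1) * exp (- \<bar>u\<bar>)))" by simp
    also have "\<dots> \<le> t ^ (N + 1) * (C1 * exp (- \<bar>u\<bar>) + C2 * (\<bar>u\<bar> ^ (N + 1) * exp (- \<bar>u\<bar>)))"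
      using C1 t by (intro mult_left_mono add_right_mono) auto
    finally show ?thesis .
  qed
qed

theorem theorem1p3:
  fixes m N :: nat and r :: int
  assumes "m > 1" and "even m"
  shows "\<exists>R :: real \<Rightarrow> complex.
           R \<in> O[at_right 0](\<lambda>t. of_real (t ^ (N + 1))) \<and>
           (\<forall>t>0. trL0 m r (\<i> * of_real t) =
              of_real (exp (pi * t / 12 + pi / (12 * t) * (3 * real m - 1)) * sqrt t / 2 ^ m) *
              ((\<Sum>k=0..N. acoeff k m r * of_real (t ^ k / fact k)) + R t))"
proof -
  obtain j where j: "m = 2 * Suc j"
    using assms by (metis One_nat_def Suc_pred dvd_mult_div_cancel mult_0_right nat_neq_iff not_gr0 not_less_zero)
  have m: "m \<ge> 2" using assms by simp
  \<comment> \<open>As a difference of integrals \<open>R\<close> makes the identity exact for every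
    \<open>t > 0\<close>; only the estimate of its size restricts to
    \<open>t \<le> 1\<close>.\<close>
  define R where "R = (\<lambda>t. (\<integral>u. scaled_integrand m r t u \<partial>lborel) - (\<integral>u. scaled_limit m r N t u \<partial>lborel))"
  define C1 where "C1 = 8 * real (m + 1) * exp (4 * real (m + 1)) * fact (N + 1)"
  define C2 where "C2 = 2 * ((2 * pi * \<bar>r\<bar>) ^ (N + 1) + 2 ^ (N + 1) * (\<Sum>k\<le>N. (2 * pi * \<bar>r\<bar>) ^ k))"
  have sum: "(\<integral>u. scaled_limit m r N t u \<partial>lborel) = (\<Sum>k=0..N. acoeff k m r * of_real (t ^ k / fact k))" for t
    unfolding scaled_limit_integral(2)[OF order.trans[OF one_le_numeral m]] acoeff_def
    unfolding j calE_even atLeast0AtMost ..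
  have "R \<in> O[at_right 0](\<lambda>t. of_real (t ^ (N + 1)))"
  proof (rule bigoI)
    have "\<forall>\<^sub>F t::real in at_right 0. 0 < t \<and> t \<le> 1"
      by (subst eventually_at_right[of 0 1]) (auto intro!: exI[of _ 1])
    then show "\<forall>\<^sub>F t in at_right 0. norm (R t) \<le> (2 * C1 + 2 * fact (N + 1) * C2) * norm (complex_of_real (t ^ (N + 1)))"
    proof eventually_elim
      case (elim t)
      then have t: "0 < t" "t \<le> 1" by auto
      have si: "integrable lborel (scaled_integrand m r t)" by (rule trL0_eq_scaled_integral(1)[OF t(1)])
      have sl: "integrable lborel (scaled_limit m r N t)"
        using m by (intro scaled_limit_integral(1)) auto
      have hb: "has_bochner_integral lborel (\<lambda>u. t ^ (N + 1) * (C1 * (\<bar>u\<bar> ^ 0 * exp (- \<bar>u\<bar>)) + C2 * (\<bar>u\<bar> ^ (N + 1) * exp (- \<bar>u\<bar>))))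
              (t ^ (N + 1) * (C1 * (2 * fact 0) + C2 * (2 * fact (N + 1))))"
        by (intro has_bochner_integral_mult_right has_bochner_integral_add has_bochner_integral_abs_power_exp)
      have "norm (R t) = norm (\<integral>u. scaled_integrand m r t u - scaled_limit m r N t u \<partial>lborel)"
        unfolding R_def using si sl by simp
      also have "\<dots> \<le> (\<integral>u. norm (scaled_integrand m r t u - scaled_limit m r N t u) \<partial>lborel)"
        by (rule integral_norm_bound)
      also have "\<dots> \<le> (\<integral>u. t ^ (N + 1) * (C1 * (\<bar>u\<bar> ^ 0 * exp (- \<bar>u\<bar>)) + C2 * (\<bar>u\<bar> ^ (N + 1) * exp (- \<bar>u\<bar>))) \<partial>lborel)"
        using scaled_integrand_error[OF m t, of r _ N] si sl hb
        by (intro integral_mono) (auto simp: C1_def C2_def has_bochner_integral_iff)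
      also have "\<dots> = t ^ (N + 1) * (C1 * (2 * fact 0) + C2 * (2 * fact (N + 1)))"
        using hb by (rule has_bochner_integral_integral_eq)
      also have "\<dots> = (2 * C1 + 2 * fact (N + 1) * C2) * norm (complex_of_real (t ^ (N + 1)))"
        using t by (simp add: norm_mult norm_power algebra_simps)
      finally show ?case .
    qed
  qed
  moreover have "trL0 m r (\<i> * of_real t) =
              of_real (exp (pi * t / 12 + pi / (12 * t) * (3 * real m - 1)) * sqrt t / 2 ^ m) *
              ((\<Sum>k=0..N. acoeff k m r * of_real (t ^ k / fact k)) + R t)" if "t > 0" for t
    unfolding trL0_eq_scaled_integral(2)[OF that] R_def sum by simp
  ultimately show ?thesis by blast
qed

end
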